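(* Fix $0<\delta<1$, $0<C<\frac{3}{4}$ and $0<B<\dfrac{1}{\sqrt{\frac{C}{3}-\frac{C^2}{3}}+C}$, and let $f(x):=x\log \frac{1}{x}+(1-x)\log\frac{1}{1-x}$. Then, as $n\to\infty$ (with $n\geq 1$ an integer), \begin{align*} \log |\mathcal M_{n,\delta}(B,C)| &=f(C)n^2+\left[2f(BC)-(BC)\log \left(\frac{1-C}{C}\right)\right]n^{1+\delta}\\ &\quad+\left[f(z_{11}^* )+z_{11}^*\log\left(\frac{1-C}{C}\cdot \frac{(BC)^2}{(1-BC)^2}\right)-\frac{B^2 C}{2(1-C)} \right]n^{2\delta}\\ &\quad+O(n^{3\delta-1}+n\log n), \end{align*} where $z_{11}^*=\dfrac{B^2(1-C)}{B^2-2B+1/C}$.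
   Context: For positive integer vectors $\mathbf r=(r_1,\ldots,r_m)$ and $\mathbf c=(c_1,\ldots,c_k)$ with $\sum_i r_i=\sum_j c_j$, let $\mathcal M(\mathbf r,\mathbf c)$ denote the set of $m\times k$ matrices with entries in $\{0,1\}$ whose $i$-th row sum is $r_i$ for all $i$ and whose $j$-th column sum is $c_j$ for all $j$ (binary contingency tables). For parameters $n,\delta,B,C$, let $\widetilde{\mathbf r}=\widetilde{\mathbf c}:=(\lfloor BCn\rfloor,\ldots,\lfloor BCn\rfloor,\lfloor Cn\rfloor,\ldots,\lfloor Cn\rfloor)\in\mathbb N^{\lfloor n^\delta\rfloor+n}$, with $\lfloor n^\delta\rfloor$ entries equal to $\lfloor BCn\rfloor$ followed by $n$ entries equal to $\lfloor Cn\rfloor$, and let $\mathcal M_{n,\delta}(B,C):=\mathcal M(\widetilde{\mathbf r},\widetilde{\mathbf c})$, i.e. the set of $(\lfloor n^\delta\rfloor+n)\times(\lfloor n^\delta\rfloor+n)$ binary matrices whose first $\lfloor n^\delta\rfloor$ rows and columns have sum $\lfloor BCn\rfloor$ and whose remaining $n$ rows and columns have sum $\lfloor Cn\rfloor$. *)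

theory Defs
  imports Complex_Main "HOL-Library.FuncSet" "HOL-Library.Landau_Symbols" "Jordan_Normal_Form.Matrix"
begin

definition binary_tables :: "nat vec \<Rightarrow> nat vec \<Rightarrow> nat mat set" where
  "binary_tables r c =
     {A \<in> carrier_mat (dim_vec r) (dim_vec c).
        (\<forall>i<dim_vec r. \<forall>j<dim_vec c. A $$ (i, j) \<in> {0, 1}) \<and>
        (\<forall>i<dim_vec r. (\<Sum>j<dim_vec c. A $$ (i, j)) = r $ i) \<and>
        (\<forall>j<dim_vec c. (\<Sum>i<dim_vec r. A $$ (i, j)) = c $ j)}"

lemma finite_binary_tables: "finite (binary_tables r c)"
proof -
  let ?I = "{..<dim_vec r} \<times> {..<dim_vec c}"
  have "binary_tables r c \<subseteq> mat (dim_vec r) (dim_vec c) ` (?I \<rightarrow>\<^sub>E {0, 1})"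
  proof
    fix A assume A: "A \<in> binary_tables r c"
    let ?f = "restrict (\<lambda>ij. A $$ ij) ?I"
    have "?f \<in> ?I \<rightarrow>\<^sub>E {0, 1}"
    proof (rule PiE_I)
      fix ij assume "ij \<in> ?I"
      then show "?f ij \<in> {0, 1}"
        using A by (cases ij) (simp add: binary_tables_def)
    qed auto
    moreover have "A = mat (dim_vec r) (dim_vec c) ?f"
      using A by (intro eq_matI) (auto simp: binary_tables_def)
    ultimately show "A \<in> mat (dim_vec r) (dim_vec c) ` (?I \<rightarrow>\<^sub>E {0, 1})"
      by blast
  qed
  then show ?thesis
    by (rule finite_subset) (simp add: finite_PiE)
qed

text \<open>Indices start at 0, so the large margins are those with index below \<open>\<lfloor>n\<^sup>\<delta>\<rfloor>\<close>.\<close>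

definition two_block_margin :: "nat \<Rightarrow> real \<Rightarrow> real \<Rightarrow> real \<Rightarrow> nat vec" where
  "two_block_margin n \<delta> B C =
     vec (nat \<lfloor>real n powr \<delta>\<rfloor> + n)
       (\<lambda>i. if i < nat \<lfloor>real n powr \<delta>\<rfloor> then nat \<lfloor>B * C * real n\<rfloor> else nat \<lfloor>C * real n\<rfloor>)"

definition two_block_tables :: "nat \<Rightarrow> real \<Rightarrow> real \<Rightarrow> real \<Rightarrow> nat mat set" where
  "two_block_tables n \<delta> B C =
     binary_tables (two_block_margin n \<delta> B C) (two_block_margin n \<delta> B C)"

definition bin_entropy :: "real \<Rightarrow> real" where
  "bin_entropy x = x * ln (1 / x) + (1 - x) * ln (1 / (1 - x))"

definition z11_star :: "real \<Rightarrow> real \<Rightarrow> real" where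
  "z11_star B C = B\<^sup>2 * (1 - C) / (B\<^sup>2 - 2 * B + 1 / C)"

end

theory Submission
  imports Defs "HOL-Real_Asymp.Real_Asymp"
begin

text \<open>
  View a table as the set of positions of its ones. Moving a unit from a larger to a smaller
  column margin never decreases the number of tables, so among all margins with given totals over
  the two blocks of rows and columns, the block-constant ones admit the most tables. As there are
  only \<open>exp (O(n log n))\<close> margins, the count agrees up to that factor with the number of 0-1
  matrices having the prescribed block totals. The latter is the sum over \<open>k\<close>, the number of ones in
  the small corner block, of \<open>(m\<^sup>2 choose k) (mn choose p)\<^sup>2 (n\<^sup>2 choose q)\<close> with
  \<open>m = \<lfloor>n\<^sup>\<delta>\<rfloor>\<close>, where \<open>p\<close> and \<open>q\<close> are determined by \<open>k\<close>. Its logarithm is the maximal block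
  entropy up to \<open>O(log n)\<close>; expanding the entropy of the two large blocks around \<open>BC\<close> and \<open>C\<close>
  leaves a concave function of \<open>k / m\<^sup>2\<close> whose maximum is attained at \<open>z11_star\<close>.
\<close>

section \<open>Balancing margins\<close>

text \<open>Encoding tables as relations makes transposition \<open>converse\<close>, blocks
  intersections with rectangles, and the move of a one a deletion followed by an insertion.\<close>

definition incidences :: "'a set \<Rightarrow> 'b set \<Rightarrow> ('a \<Rightarrow> nat) \<Rightarrow> ('b \<Rightarrow> nat) \<Rightarrow> ('a \<times> 'b) set set" where
  "incidences X Y r c =
     {E. E \<subseteq> X \<times> Y \<and> (\<forall>i\<in>X. card (E `` {i}) = r i) \<and> (\<forall>j\<in>Y. card (E\<inverse> `` {j}) = c j)}"

lemma finite_incidences: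
  assumes "finite X" "finite Y"
  shows "finite (incidences X Y r c)"
  by (rule finite_subset[of _ "Pow (X \<times> Y)"]) (use assms in \<open>auto simp: incidences_def\<close>)

lemma incidences_cong:
  assumes "\<And>i. i \<in> X \<Longrightarrow> r i = r' i" "\<And>j. j \<in> Y \<Longrightarrow> c j = c' j"
  shows "incidences X Y r c = incidences X Y r' c'"
  using assms by (auto simp: incidences_def)

lemma card_incidences_converse: "card (incidences Y X c r) = card (incidences X Y r c)"
proof (rule bij_betw_same_card)
  show "bij_betw converse (incidences Y X c r) (incidences X Y r c)"
    by (rule bij_betw_byWitness[where f' = converse]) (auto simp: incidences_def)
qed

text \<open>
  Double counting of the moves of a single one from column \<open>j\<close> to \<open>j'\<close>: each table has
  \<open>card (D E)\<close> outgoing moves, and its neighbours have at most that many incoming ones.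
\<close>

lemma card_incidences_shift_le:
  fixes c :: "'b \<Rightarrow> nat"
  assumes fin: "finite X" "finite Y" and j: "j \<in> Y" "j' \<in> Y" and gap: "c j' + 2 \<le> c j"
  shows "card (incidences X Y r c) \<le> card (incidences X Y r (c(j := c j - 1, j' := c j' + 1)))"
proof -
  let ?S = "incidences X Y r c" and ?c' = "c(j := c j - 1, j' := c j' + 1)"
  let ?S' = "incidences X Y r ?c'"
  \<comment> \<open>\<open>D E\<close> collects the rows in which a one can move from column
    \<open>j\<close> to \<open>j'\<close>; \<open>D' E\<close> those in which it can move
    back.\<close>
  define D where "D E = E\<inverse> `` {j} - E\<inverse> `` {j'}" for E :: "('a \<times> 'b) set"
  define D' where "D' E = E\<inverse> `` {j'} - E\<inverse> `` {j}" for E :: "('a \<times> 'b) set"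
  \<comment> \<open>Keeping the row next to the new table records which move was made, so that
    \<open>g\<close> can be undone.\<close>
  define g where "g = (\<lambda>(E :: ('a \<times> 'b) set, i). (insert (i, j') (E - {(i, j)}), i))"
  have neq: "j \<noteq> j'" using gap by auto
  have finE: "finite (E\<inverse> `` {l})" if "E \<in> incidences X Y r' c'" for E l r' c'
    by (rule finite_subset[OF _ fin(1)]) (use that in \<open>auto simp: incidences_def\<close>)
  have finD: "finite (D E)" "finite (D' E)" if "E \<in> incidences X Y r' c'" for E r' c'
    using finE[OF that] by (auto simp: D_def D'_def)
  \<comment> \<open>Rows with ones in both columns cancel, so the two counts differ exactly as the
    column sums do.\<close>
  have cardD: "card (D E) + c j' = card (D' E) + c j" if E: "E \<in> ?S" for E
  proof -
    have "card (D E \<union> E\<inverse> `` {j'}) = card (D E) + card (E\<inverse> `` {j'})"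
      by (rule card_Un_disjoint) (use finE[OF E] finD[OF E] in \<open>auto simp: D_def\<close>)
    moreover have "card (D' E \<union> E\<inverse> `` {j}) = card (D' E) + card (E\<inverse> `` {j})"
      by (rule card_Un_disjoint) (use finE[OF E] finD[OF E] in \<open>auto simp: D'_def\<close>)
    moreover have "D E \<union> E\<inverse> `` {j'} = D' E \<union> E\<inverse> `` {j}" by (auto simp: D_def D'_def)
    ultimately show ?thesis using E j by (auto simp: incidences_def)
  qed
  have inj: "inj_on g (Sigma ?S D)"
  proof (rule inj_onI, clarify)
    fix E i F k assume *: "i \<in> D E" "k \<in> D F" "g (E, i) = g (F, k)"
    then have ik: "k = i" and eq: "insert (i, j') (E - {(i, j)}) = insert (i, j') (F - {(i, j)})"
      by (auto simp: g_def)
    have "(i, j) \<in> E" "(i, j') \<notin> E" "(i, j) \<in> F" "(i, j') \<notin> F" using * ik by (auto simp: D_def)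
    then have "E = insert (i, j) (insert (i, j') (E - {(i, j)}) - {(i, j')})"
      "F = insert (i, j) (insert (i, j') (F - {(i, j)}) - {(i, j')})" by auto
    then show "E = F \<and> i = k" using eq ik by simp
  qed
  \<comment> \<open>The move adds only \<open>i\<close> to \<open>D' E\<close>, and by
    \<open>cardD\<close> and \<open>gap\<close> there is room for it below
    \<open>card (D E)\<close>.\<close>
  have img: "g (E, i) \<in> Sigma ?S' D'" and wt: "card (D' (fst (g (E, i)))) \<le> card (D E)"
    if E: "E \<in> ?S" and i: "i \<in> D E" for E i
  proof -
    let ?E = "insert (i, j') (E - {(i, j)})"
    have mem: "(i, j) \<in> E" "(i, j') \<notin> E" and sub: "E \<subseteq> X \<times> Y" and iX: "i \<in> X"
      using E i by (auto simp: D_def incidences_def)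
    have rows: "card (?E `` {l}) = r l" if l: "l \<in> X" for l
    proof (cases "l = i")
      case True
      have eq: "?E `` {l} = insert j' (E `` {l} - {j})" using True by auto
      have fr: "finite (E `` {l})" by (rule finite_subset[OF _ fin(2)]) (use sub in auto)
      have "card (insert j' (E `` {l} - {j})) = Suc (card (E `` {l} - {j}))"
        by (rule card_insert_disjoint) (use fr mem True in auto)
      also have "\<dots> = card (E `` {l})"
        using card_Suc_Diff1[OF fr, of j] mem True by auto
      finally show ?thesis using eq E l by (simp add: incidences_def)
    next
      case False
      then have "?E `` {l} = E `` {l}" by auto
      then show ?thesis using E l by (simp add: incidences_def)
    qed
    have colj: "?E\<inverse> `` {j} = E\<inverse> `` {j} - {i}" using neq by auto
    have colj': "?E\<inverse> `` {j'} = insert i (E\<inverse> `` {j'})" using neq by auto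
    have cols: "card (?E\<inverse> `` {l}) = ?c' l" if l: "l \<in> Y" for l
    proof -
      consider "l = j" | "l = j'" | "l \<noteq> j" "l \<noteq> j'" by blast
      then show ?thesis
      proof cases
        case 1
        have "card (E\<inverse> `` {j} - {i}) = card (E\<inverse> `` {j}) - 1"
          using mem by (intro card_Diff_singleton) auto
        then show ?thesis using 1 colj neq E j by (simp add: incidences_def)
      next
        case 2
        have "card (insert i (E\<inverse> `` {j'})) = Suc (card (E\<inverse> `` {j'}))"
          using mem finE[OF E] by (intro card_insert_disjoint) auto
        then show ?thesis using 2 colj' neq E j by (simp add: incidences_def)
      next
        case 3
        then have "?E\<inverse> `` {l} = E\<inverse> `` {l}" by auto
        then show ?thesis using E l 3 by (simp add: incidences_def)
      qed
    qed
    have "?E \<in> ?S'" using rows cols sub iX j by (auto simp: incidences_def)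
    moreover have D': "D' ?E = insert i (D' E)" using colj colj' mem by (auto simp: D'_def)
    ultimately show "g (E, i) \<in> Sigma ?S' D'" by (auto simp: g_def)
    have "i \<notin> D' E" using mem by (auto simp: D'_def)
    then have "card (D' ?E) = Suc (card (D' E))" using D' finD[OF E] by simp
    then show "card (D' (fst (g (E, i)))) \<le> card (D E)"
      using cardD[OF E] gap by (simp add: g_def)
  qed
  have finS: "finite ?S" "finite ?S'" using fin by (auto intro: finite_incidences)
  \<comment> \<open>Each table spreads weight 1 evenly over its outgoing moves; \<open>gap\<close>
    makes \<open>D E\<close> nonempty.\<close>
  have "real (card ?S) = (\<Sum>E\<in>?S. \<Sum>i\<in>D E. 1 / real (card (D E)))"
  proof -
    have "(\<Sum>i\<in>D E. 1 / real (card (D E))) = 1" if "E \<in> ?S" for E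
      using cardD[OF that] gap by auto
    then show ?thesis by simp
  qed
  also have "\<dots> = (\<Sum>(E, i)\<in>Sigma ?S D. 1 / real (card (D E)))"
    by (rule sum.Sigma) (use finS finD in auto)
  also have "\<dots> \<le> (\<Sum>p\<in>Sigma ?S D. 1 / real (card (D' (fst (g p)))))"
  proof (rule sum_mono, clarify)
    fix E i assume E: "E \<in> ?S" and i: "i \<in> D E"
    have "D' (fst (g (E, i))) \<noteq> {}" using img[OF E i] by (auto simp: Sigma_def g_def)
    then have "card (D' (fst (g (E, i)))) > 0"
      using img[OF E i] finD(2) by (auto simp: card_gt_0_iff g_def)
    then show "1 / real (card (D E)) \<le> 1 / real (card (D' (fst (g (E, i)))))"
      using wt[OF E i] by (intro divide_left_mono) auto
  qed
  also have "\<dots> = (\<Sum>p\<in>g ` Sigma ?S D. 1 / real (card (D' (fst p))))"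
    by (simp add: sum.reindex[OF inj])
  also have "\<dots> \<le> (\<Sum>p\<in>Sigma ?S' D'. 1 / real (card (D' (fst p))))"
  proof (rule sum_mono2)
    show "g ` Sigma ?S D \<subseteq> Sigma ?S' D'" using img by (intro image_subsetI) blast
  qed (use finS finD in auto)
  also have "\<dots> = (\<Sum>E\<in>?S'. \<Sum>i\<in>D' E. 1 / real (card (D' E)))"
    by (subst sum.Sigma) (use finS finD in \<open>auto simp: case_prod_beta\<close>)
  \<comment> \<open>The inner sum is 1, or 0 if \<open>D' E\<close> is empty.\<close>
  also have "\<dots> \<le> (\<Sum>E\<in>?S'. 1)" by (rule sum_mono) auto
  finally show ?thesis by simp
qed

text \<open>Induction on the total distance of \<open>c\<close> from \<open>d\<close> on
  \<open>J\<close>. As \<open>d\<close> is the mean, a nonconstant \<open>c\<close> has values on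
  both sides of \<open>d\<close>, hence two values at least 2 apart; transferring a unit between
  them lowers the distance without losing tables.\<close>

lemma card_incidences_le_block:
  fixes c :: "'b \<Rightarrow> nat"
  assumes fin: "finite X" "finite Y" and J: "J \<subseteq> Y" and tot: "sum c J = card J * d"
  shows "card (incidences X Y r c) \<le> card (incidences X Y r (\<lambda>j. if j \<in> J then d else c j))"
  using tot
proof (induction "\<Sum>j\<in>J. nat \<bar>int (c j) - int d\<bar>" arbitrary: c rule: less_induct)
  case less
  have finJ: "finite J" using J fin finite_subset by blast
  show ?case
  proof (cases "\<forall>j\<in>J. c j = d")
    case True
    then have "(\<lambda>j. if j \<in> J then d else c j) = c" by auto
    then show ?thesis by simp
  next
    case False
    have "\<exists>j\<in>J. d < c j"
    proof (rule ccontr)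
      assume "\<not> ?thesis"
      then have le: "\<forall>j\<in>J. c j \<le> d" by auto
      with False have "\<exists>j\<in>J. c j < d" by force
      then have "sum c J < (\<Sum>j\<in>J. d)" using le finJ by (intro sum_strict_mono_ex1) auto
      then show False using less.prems by simp
    qed
    then obtain j where j: "j \<in> J" "d < c j" by blast
    have "\<exists>j\<in>J. c j < d"
    proof (rule ccontr)
      assume "\<not> ?thesis"
      then have "(\<Sum>j\<in>J. d) < sum c J" using j finJ by (intro sum_strict_mono_ex1) auto
      then show False using less.prems by simp
    qed
    then obtain j' where j': "j' \<in> J" "c j' < d" by blast
    let ?c = "c(j := c j - 1, j' := c j' + 1)"
    have neq: "j \<noteq> j'" using j j' by auto
    have split: "sum h J = h j + h j' + sum h (J - {j, j'})" for h :: "'b \<Rightarrow> nat"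
    proof -
      have "J = insert j (insert j' (J - {j, j'}))" using j j' by auto
      then have "sum h J = sum h (insert j (insert j' (J - {j, j'})))" by simp
      then show ?thesis using neq finJ by simp
    qed
    have rest: "(\<Sum>l\<in>J - {j, j'}. h (?c l)) = (\<Sum>l\<in>J - {j, j'}. h (c l))" for h :: "nat \<Rightarrow> nat"
      by (rule sum.cong) auto
    have "sum ?c J = sum c J" using j j' neq rest[of "\<lambda>x. x"] by (simp add: split)
    moreover have "(\<Sum>l\<in>J. nat \<bar>int (?c l) - int d\<bar>) < (\<Sum>l\<in>J. nat \<bar>int (c l) - int d\<bar>)"
      using j j' neq unfolding split rest[of "\<lambda>x. nat \<bar>int x - int d\<bar>"] by simp
    ultimately have "card (incidences X Y r ?c)
        \<le> card (incidences X Y r (\<lambda>l. if l \<in> J then d else ?c l))"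
      using less.hyps[of ?c] less.prems by simp
    \<comment> \<open>Both changed indices lie in \<open>J\<close>, where the value is overwritten
      by \<open>d\<close>.\<close>
    also have "(\<lambda>l. if l \<in> J then d else ?c l) = (\<lambda>l. if l \<in> J then d else c l)"
      using j j' by auto
    finally have "card (incidences X Y r ?c) \<le> card (incidences X Y r (\<lambda>l. if l \<in> J then d else c l))" .
    moreover have "card (incidences X Y r c) \<le> card (incidences X Y r ?c)"
      by (rule card_incidences_shift_le) (use fin j j' J in auto)
    ultimately show ?thesis by linarith
  qed
qed

text \<open>Balancing the columns, first on \<open>V\<close> and then on \<open>W\<close>, works for
  any row margin. Passing to converse relations then balances the rows by the same argument.\<close>

lemma card_incidences_le_two_blocks:
  fixes r c :: "'a \<Rightarrow> nat"
  assumes fin: "finite V" "finite W" and disj: "V \<inter> W = {}"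
    and tot: "sum r V = card V * a" "sum r W = card W * b"
      "sum c V = card V * a" "sum c W = card W * b"
  shows "card (incidences (V \<union> W) (V \<union> W) r c)
    \<le> card (incidences (V \<union> W) (V \<union> W) (\<lambda>i. if i \<in> V then a else b) (\<lambda>i. if i \<in> V then a else b))"
proof -
  let ?U = "V \<union> W" and ?s = "\<lambda>i. if i \<in> V then a else b"
  have balance: "card (incidences ?U ?U \<rho> \<kappa>) \<le> card (incidences ?U ?U \<rho> ?s)"
    if "sum \<kappa> V = card V * a" "sum \<kappa> W = card W * b" for \<rho> \<kappa> :: "'a \<Rightarrow> nat"
  proof -
    let ?k = "\<lambda>i. if i \<in> V then a else \<kappa> i"
    have "card (incidences ?U ?U \<rho> \<kappa>) \<le> card (incidences ?U ?U \<rho> ?k)"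
      by (rule card_incidences_le_block) (use fin that in auto)
    also have "sum ?k W = sum \<kappa> W" using disj by (intro sum.cong) auto
    then have "card (incidences ?U ?U \<rho> ?k)
        \<le> card (incidences ?U ?U \<rho> (\<lambda>i. if i \<in> W then b else ?k i))"
      by (intro card_incidences_le_block) (use fin that in auto)
    also have "incidences ?U ?U \<rho> (\<lambda>i. if i \<in> W then b else ?k i) = incidences ?U ?U \<rho> ?s"
      by (rule incidences_cong) (use disj in auto)
    finally show ?thesis .
  qed
  have "card (incidences ?U ?U r c) \<le> card (incidences ?U ?U r ?s)"
    by (rule balance) (use tot in auto)
  also have "\<dots> = card (incidences ?U ?U ?s r)"
    by (rule card_incidences_converse)
  also have "\<dots> \<le> card (incidences ?U ?U ?s ?s)"
    by (rule balance) (use tot in auto)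
  finally show ?thesis .
qed

section \<open>Prescribed block totals\<close>

lemma card_Int_Times_rows:
  assumes "finite V" "finite Y" "E \<subseteq> X \<times> Y"
  shows "card (E \<inter> V \<times> Y) = (\<Sum>i\<in>V. card (E `` {i}))"
proof -
  have "E \<inter> V \<times> Y = Sigma V (\<lambda>i. E `` {i})" using assms by auto
  moreover have "finite (E `` {i})" for i by (rule finite_subset[OF _ assms(2)]) (use assms in auto)
  ultimately show ?thesis using assms by simp
qed

lemma card_Int_Times_cols:
  assumes "finite W" "finite X" "E \<subseteq> X \<times> Y"
  shows "card (E \<inter> X \<times> W) = (\<Sum>j\<in>W. card (E\<inverse> `` {j}))"
proof -
  have "card (E \<inter> X \<times> W) = card ((E \<inter> X \<times> W)\<inverse>)" by (simp add: card_inverse)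
  also have "(E \<inter> X \<times> W)\<inverse> = E\<inverse> \<inter> W \<times> X" by auto
  also have "card \<dots> = (\<Sum>j\<in>W. card (E\<inverse> `` {j}))"
    by (rule card_Int_Times_rows) (use assms in auto)
  finally show ?thesis .
qed

text \<open>One number \<open>p\<close> serves both off-diagonal blocks: when row and column margins
  agree, the row total and the column total over \<open>V\<close> exceed the corner total by the
  same amount.\<close>

definition block_incidences :: "'a set \<Rightarrow> 'a set \<Rightarrow> nat \<Rightarrow> nat \<Rightarrow> nat \<Rightarrow> ('a \<times> 'a) set set" where
  "block_incidences V W k p q =
     {E. E \<subseteq> (V \<union> W) \<times> (V \<union> W) \<and> card (E \<inter> V \<times> V) = k \<and> card (E \<inter> V \<times> W) = p
       \<and> card (E \<inter> W \<times> V) = p \<and> card (E \<inter> W \<times> W) = q}"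

lemma finite_block_incidences:
  assumes "finite V" "finite W"
  shows "finite (block_incidences V W k p q)"
  by (rule finite_subset[of _ "Pow ((V \<union> W) \<times> (V \<union> W))"])
    (use assms in \<open>auto simp: block_incidences_def\<close>)

text \<open>The four rectangles partition the square, so such a relation is an independent choice of
  a subset of prescribed size in each of them.\<close>

lemma card_block_incidences:
  assumes fin: "finite V" "finite W" and disj: "V \<inter> W = {}"
  shows "card (block_incidences V W k p q) =
    ((card V)\<^sup>2 choose k) * ((card V * card W) choose p)\<^sup>2 * ((card W)\<^sup>2 choose q)"
proof -
  define sub where "sub S k = {A. A \<subseteq> S \<and> card A = k}" for S :: "('a \<times> 'a) set" and k
  let ?P = "sub (V \<times> V) k \<times> sub (V \<times> W) p \<times> sub (W \<times> V) p \<times> sub (W \<times> W) q"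
  have "bij_betw (\<lambda>E. (E \<inter> V \<times> V, E \<inter> V \<times> W, E \<inter> W \<times> V, E \<inter> W \<times> W))
     (block_incidences V W k p q) ?P"
  proof (rule bij_betw_byWitness[where f' = "\<lambda>(A, B, C, D). A \<union> B \<union> C \<union> D"])
    show "\<forall>E\<in>block_incidences V W k p q. (\<lambda>(A, B, C, D). A \<union> B \<union> C \<union> D)
        (E \<inter> V \<times> V, E \<inter> V \<times> W, E \<inter> W \<times> V, E \<inter> W \<times> W) = E"
      by (auto simp: block_incidences_def)
    have parts: "(A \<union> B \<union> C \<union> D) \<inter> V \<times> V = A" "(A \<union> B \<union> C \<union> D) \<inter> V \<times> W = B"
      "(A \<union> B \<union> C \<union> D) \<inter> W \<times> V = C" "(A \<union> B \<union> C \<union> D) \<inter> W \<times> W = D"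
      if "A \<subseteq> V \<times> V" "B \<subseteq> V \<times> W" "C \<subseteq> W \<times> V" "D \<subseteq> W \<times> W" for A B C D
      using that disj by auto
    show "\<forall>P\<in>?P. (\<lambda>E. (E \<inter> V \<times> V, E \<inter> V \<times> W, E \<inter> W \<times> V, E \<inter> W \<times> W))
        ((\<lambda>(A, B, C, D). A \<union> B \<union> C \<union> D) P) = P"
    proof
      fix P assume P: "P \<in> ?P"
      obtain A B C D where [simp]: "P = (A, B, C, D)" by (metis prod_cases4)
      show "(\<lambda>E. (E \<inter> V \<times> V, E \<inter> V \<times> W, E \<inter> W \<times> V, E \<inter> W \<times> W))
        ((\<lambda>(A, B, C, D). A \<union> B \<union> C \<union> D) P) = P"
        using P parts[of A B C D] by (simp add: sub_def)
    qed
    show "(\<lambda>E. (E \<inter> V \<times> V, E \<inter> V \<times> W, E \<inter> W \<times> V, E \<inter> W \<times> W)) ` block_incidences V W k p q \<subseteq> ?P"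
      by (auto simp: block_incidences_def sub_def)
    show "(\<lambda>(A, B, C, D). A \<union> B \<union> C \<union> D) ` ?P \<subseteq> block_incidences V W k p q"
    proof clarify
      fix A B C D
      assume *: "A \<in> sub (V \<times> V) k" "B \<in> sub (V \<times> W) p" "C \<in> sub (W \<times> V) p" "D \<in> sub (W \<times> W) q"
      then have "A \<union> B \<union> C \<union> D \<subseteq> (V \<union> W) \<times> (V \<union> W)" by (auto simp: sub_def)
      then show "A \<union> B \<union> C \<union> D \<in> block_incidences V W k p q"
        using * parts[of A B C D] by (simp add: block_incidences_def sub_def)
    qed
  qed
  then have "card (block_incidences V W k p q) = card ?P" by (rule bij_betw_same_card)
  also have "\<dots> = ((card V)\<^sup>2 choose k) * ((card V * card W) choose p)\<^sup>2 * ((card W)\<^sup>2 choose q)"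
    using fin unfolding sub_def
    by (simp add: card_cartesian_product n_subsets power2_eq_square mult_ac)
  finally show ?thesis .
qed

text \<open>Counting the ones along the rows in \<open>V\<close>, the columns in \<open>V\<close>
  and the rows in \<open>W\<close> leaves the corner total \<open>k\<close> as the only free
  parameter; \<open>p\<close> and \<open>q\<close> follow from it.\<close>

lemma two_block_incidences_cases:
  fixes a b :: nat
  assumes fin: "finite V" "finite W" and disj: "V \<inter> W = {}"
    and E: "E \<in> incidences (V \<union> W) (V \<union> W) (\<lambda>i. if i \<in> V then a else b) (\<lambda>i. if i \<in> V then a else b)"
  obtains k p q where "E \<in> block_incidences V W k p q" "k + p = card V * a" "p + q = card W * b"
    "k \<le> (card V)\<^sup>2" "p \<le> card V * card W" "q \<le> (card W)\<^sup>2"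
proof -
  let ?U = "V \<union> W" and ?s = "\<lambda>i. if i \<in> V then a else b"
  have sub: "E \<subseteq> ?U \<times> ?U" and rows: "\<And>i. i \<in> ?U \<Longrightarrow> card (E `` {i}) = ?s i"
    and cols: "\<And>j. j \<in> ?U \<Longrightarrow> card (E\<inverse> `` {j}) = ?s j"
    using E by (auto simp: incidences_def)
  have finU: "finite ?U" using fin by simp
  have finE: "finite E" by (rule finite_subset[OF sub]) (use finU in auto)
  have row: "card (E \<inter> Z \<times> V) + card (E \<inter> Z \<times> W) = sum ?s Z" if "Z \<subseteq> ?U" for Z
  proof -
    have "card (E \<inter> Z \<times> ?U) = (\<Sum>i\<in>Z. card (E `` {i}))"
      by (rule card_Int_Times_rows[OF _ finU sub]) (use that finU finite_subset in auto)
    also have "\<dots> = sum ?s Z" using that rows by (intro sum.cong) auto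
    also have "E \<inter> Z \<times> ?U = (E \<inter> Z \<times> V) \<union> (E \<inter> Z \<times> W)" by auto
    also have "card \<dots> = card (E \<inter> Z \<times> V) + card (E \<inter> Z \<times> W)"
      by (rule card_Un_disjoint) (use finE disj in auto)
    finally show ?thesis .
  qed
  have col: "card (E \<inter> V \<times> V) + card (E \<inter> W \<times> V) = sum ?s V"
  proof -
    have "card (E \<inter> ?U \<times> V) = (\<Sum>j\<in>V. card (E\<inverse> `` {j}))"
      by (rule card_Int_Times_cols[OF fin(1) finU sub])
    also have "\<dots> = sum ?s V" using cols by (intro sum.cong) auto
    also have "E \<inter> ?U \<times> V = (E \<inter> V \<times> V) \<union> (E \<inter> W \<times> V)" by auto
    also have "card \<dots> = card (E \<inter> V \<times> V) + card (E \<inter> W \<times> V)"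
      by (rule card_Un_disjoint) (use finE disj in auto)
    finally show ?thesis .
  qed
  have sV: "sum ?s V = card V * a" by simp
  have "sum ?s W = (\<Sum>i\<in>W. b)" using disj by (intro sum.cong) auto
  then have sW: "sum ?s W = card W * b" by simp
  have le: "card (E \<inter> Y \<times> Z) \<le> card Y * card Z" if "finite Y" "finite Z" for Y Z
    using card_mono[of "Y \<times> Z" "E \<inter> Y \<times> Z"] that by (simp add: card_cartesian_product)
  show thesis
  proof (rule that[of "card (E \<inter> V \<times> V)" "card (E \<inter> V \<times> W)" "card (E \<inter> W \<times> W)"])
    show "E \<in> block_incidences V W (card (E \<inter> V \<times> V)) (card (E \<inter> V \<times> W)) (card (E \<inter> W \<times> W))"
      using sub row[of V] col by (simp add: block_incidences_def)
    show "card (E \<inter> V \<times> V) + card (E \<inter> V \<times> W) = card V * a" using row[of V] sV by simp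
    show "card (E \<inter> V \<times> W) + card (E \<inter> W \<times> W) = card W * b"
      using row[of V] row[of W] col sW by simp
  qed (use le fin in \<open>auto simp: power2_eq_square\<close>)
qed

text \<open>Sorting the tables by their corner total \<open>k\<close> gives at most
  \<open>(card V)^2 + 1\<close> nonempty classes, and each lies inside a single
  \<open>block_incidences\<close> set because \<open>k\<close> fixes \<open>p\<close> and
  \<open>q\<close>.\<close>

lemma card_two_block_incidences_le:
  fixes a b :: nat and K :: real
  assumes fin: "finite V" "finite W" and disj: "V \<inter> W = {}" and K: "0 \<le> K"
    and bound: "\<And>k p q. k + p = card V * a \<Longrightarrow> p + q = card W * b \<Longrightarrow> k \<le> (card V)\<^sup>2 \<Longrightarrow>
      p \<le> card V * card W \<Longrightarrow> q \<le> (card W)\<^sup>2 \<Longrightarrow> real (card (block_incidences V W k p q)) \<le> K"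
  shows "real (card (incidences (V \<union> W) (V \<union> W) (\<lambda>i. if i \<in> V then a else b)
      (\<lambda>i. if i \<in> V then a else b))) \<le> ((real (card V))\<^sup>2 + 1) * K"
proof -
  let ?M = "incidences (V \<union> W) (V \<union> W) (\<lambda>i. if i \<in> V then a else b) (\<lambda>i. if i \<in> V then a else b)"
  define F where "F k = {E \<in> ?M. card (E \<inter> V \<times> V) = k}" for k
  have finM: "finite ?M" using fin by (intro finite_incidences) auto
  have F_le: "real (card (F k)) \<le> K" for k
  proof (cases "F k = {}")
    case True
    then show ?thesis using K by simp
  next
    case False
    \<comment> \<open>Any member of the class supplies the \<open>p\<close> and \<open>q\<close> at
      which \<open>bound\<close> is applied.\<close>
    then obtain E where E: "E \<in> ?M" "card (E \<inter> V \<times> V) = k" by (auto simp: F_def)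
    obtain k0 p q where kpq: "E \<in> block_incidences V W k0 p q" "k0 + p = card V * a" "p + q = card W * b"
      "k0 \<le> (card V)\<^sup>2" "p \<le> card V * card W" "q \<le> (card W)\<^sup>2"
      using two_block_incidences_cases[OF fin disj E(1)] by metis
    have "k0 = k" using kpq(1) E(2) by (simp add: block_incidences_def)
    have "F k \<subseteq> block_incidences V W k p q"
    proof
      fix E' assume E': "E' \<in> F k"
      then have "E' \<in> ?M" by (simp add: F_def)
      from two_block_incidences_cases[OF fin disj this] obtain k1 p1 q1 where
        1: "E' \<in> block_incidences V W k1 p1 q1" "k1 + p1 = card V * a" "p1 + q1 = card W * b" by metis
      moreover have "k1 = k" using 1(1) E' by (simp add: block_incidences_def F_def)
      moreover have "p1 = p" "q1 = q" using calculation kpq \<open>k0 = k\<close> by linarith+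
      ultimately show "E' \<in> block_incidences V W k p q" by simp
    qed
    then have "card (F k) \<le> card (block_incidences V W k p q)"
      by (rule card_mono[rotated]) (rule finite_block_incidences[OF fin])
    also have "real (card (block_incidences V W k p q)) \<le> K"
      using bound kpq \<open>k0 = k\<close> by auto
    finally show ?thesis by simp
  qed
  have "?M \<subseteq> (\<Union>k\<le>(card V)\<^sup>2. F k)"
  proof
    fix E assume E: "E \<in> ?M"
    from two_block_incidences_cases[OF fin disj E] obtain k p q where
      "E \<in> block_incidences V W k p q" "k \<le> (card V)\<^sup>2" by metis
    then show "E \<in> (\<Union>k\<le>(card V)\<^sup>2. F k)" using E by (auto simp: F_def block_incidences_def)
  qed
  then have "card ?M \<le> card (\<Union>k\<le>(card V)\<^sup>2. F k)"
    by (rule card_mono[rotated]) (use finM in \<open>auto simp: F_def\<close>)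
  also have "\<dots> \<le> (\<Sum>k\<le>(card V)\<^sup>2. card (F k))" by (rule card_UN_le) simp
  finally have "real (card ?M) \<le> (\<Sum>k\<le>(card V)\<^sup>2. real (card (F k)))" by (simp flip: of_nat_sum)
  also have "\<dots> \<le> (\<Sum>k\<le>(card V)\<^sup>2. K)" by (rule sum_mono) (rule F_le)
  finally show ?thesis by (simp add: algebra_simps)
qed

text \<open>Every relation with these block totals has row and column margins with matching sums
  over \<open>V\<close> and \<open>W\<close>. With N indices there are at most
  \<open>(N + 1)^N\<close> candidates for each margin, and by balancing no pair of them admits more
  tables than the block-constant pair.\<close>

lemma card_block_incidences_le:
  fixes a b :: nat
  assumes fin: "finite V" "finite W" and disj: "V \<inter> W = {}"
    and tot: "k + p = card V * a" "p + q = card W * b"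
  shows "card (block_incidences V W k p q)
    \<le> (card V + card W + 1) ^ (2 * (card V + card W)) *
      card (incidences (V \<union> W) (V \<union> W) (\<lambda>i. if i \<in> V then a else b) (\<lambda>i. if i \<in> V then a else b))"
proof -
  let ?U = "V \<union> W" and ?N = "card V + card W"
  let ?M = "incidences ?U ?U (\<lambda>i. if i \<in> V then a else b) (\<lambda>i. if i \<in> V then a else b)"
  have finU: "finite ?U" and cU: "card ?U = ?N" using fin disj by (auto simp: card_Un_disjoint)
  \<comment> \<open>Margins are taken extensional and bounded by \<open>?N\<close>, so that
    \<open>card_PiE\<close> limits their number.\<close>
  define Q where "Q = {f \<in> ?U \<rightarrow>\<^sub>E {..?N}. sum f V = card V * a \<and> sum f W = card W * b}"
  have QF: "Q \<subseteq> ?U \<rightarrow>\<^sub>E {..?N}" by (auto simp: Q_def)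
  have finF: "finite (?U \<rightarrow>\<^sub>E {..?N})" using finU by (auto intro: finite_PiE)
  have finQ: "finite Q" using QF finF by (rule finite_subset)
  have cQ: "card Q \<le> (?N + 1) ^ ?N"
  proof -
    have "card Q \<le> card (?U \<rightarrow>\<^sub>E {..?N})" by (rule card_mono[OF finF QF])
    also have "\<dots> = (?N + 1) ^ ?N" using cU finU by (simp add: card_PiE)
    finally show ?thesis .
  qed
  have "block_incidences V W k p q \<subseteq> (\<Union>(r, c)\<in>Q \<times> Q. incidences ?U ?U r c)"
  proof
    fix E assume E: "E \<in> block_incidences V W k p q"
    let ?r = "restrict (\<lambda>i. card (E `` {i})) ?U" and ?c = "restrict (\<lambda>j. card (E\<inverse> `` {j})) ?U"
    have sub: "E \<subseteq> ?U \<times> ?U" using E by (simp add: block_incidences_def)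
    have finE: "finite E" by (rule finite_subset[OF sub]) (use finU in auto)
    have "card (E `` {i}) \<le> ?N" "card (E\<inverse> `` {i}) \<le> ?N" for i
      unfolding cU[symmetric] by (rule card_mono[OF finU]; use sub in auto)+
    then have PiE: "?r \<in> ?U \<rightarrow>\<^sub>E {..?N}" "?c \<in> ?U \<rightarrow>\<^sub>E {..?N}" by auto
    have rs: "sum ?r Z = card (E \<inter> Z \<times> V) + card (E \<inter> Z \<times> W)" if Z: "Z \<subseteq> ?U" for Z
    proof -
      have "sum ?r Z = (\<Sum>i\<in>Z. card (E `` {i}))" using Z by (intro sum.cong) auto
      also have "\<dots> = card (E \<inter> Z \<times> ?U)"
        by (rule card_Int_Times_rows[OF _ finU sub, symmetric]) (use Z finU finite_subset in auto)
      also have "E \<inter> Z \<times> ?U = (E \<inter> Z \<times> V) \<union> (E \<inter> Z \<times> W)" by auto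
      also have "card \<dots> = card (E \<inter> Z \<times> V) + card (E \<inter> Z \<times> W)"
        by (rule card_Un_disjoint) (use finE disj in auto)
      finally show ?thesis .
    qed
    have cs: "sum ?c Z = card (E \<inter> V \<times> Z) + card (E \<inter> W \<times> Z)" if Z: "Z \<subseteq> ?U" for Z
    proof -
      have "sum ?c Z = (\<Sum>i\<in>Z. card (E\<inverse> `` {i}))" using Z by (intro sum.cong) auto
      also have "\<dots> = card (E \<inter> ?U \<times> Z)"
        by (rule card_Int_Times_cols[OF _ finU sub, symmetric]) (use Z finU finite_subset in auto)
      also have "E \<inter> ?U \<times> Z = (E \<inter> V \<times> Z) \<union> (E \<inter> W \<times> Z)" by auto
      also have "card \<dots> = card (E \<inter> V \<times> Z) + card (E \<inter> W \<times> Z)"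
        by (rule card_Un_disjoint) (use finE disj in auto)
      finally show ?thesis .
    qed
    have "?r \<in> Q" "?c \<in> Q"
      using PiE rs[of V] rs[of W] cs[of V] cs[of W] E tot
      by (simp_all add: Q_def block_incidences_def)
    moreover have "E \<in> incidences ?U ?U ?r ?c" using sub by (simp add: incidences_def)
    ultimately show "E \<in> (\<Union>(r, c)\<in>Q \<times> Q. incidences ?U ?U r c)" by blast
  qed
  then have "card (block_incidences V W k p q) \<le> card (\<Union>(r, c)\<in>Q \<times> Q. incidences ?U ?U r c)"
    by (rule card_mono[rotated]) (use finQ finU in \<open>auto intro: finite_incidences\<close>)
  also have "\<dots> \<le> (\<Sum>x\<in>Q \<times> Q. card (case x of (r, c) \<Rightarrow> incidences ?U ?U r c))"
    by (rule card_UN_le) (use finQ in auto)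
  also have "\<dots> \<le> (\<Sum>x\<in>Q \<times> Q. card ?M)"
    by (rule sum_mono, clarsimp, rule card_incidences_le_two_blocks)
      (use fin disj in \<open>auto simp: Q_def\<close>)
  also have "\<dots> = card Q * card Q * card ?M" by (simp add: card_cartesian_product)
  also have "\<dots> \<le> (?N + 1) ^ ?N * (?N + 1) ^ ?N * card ?M"
    by (intro mult_mono cQ) auto
  also have "\<dots> = (?N + 1) ^ (2 * ?N) * card ?M" by (simp add: mult_2 power_add)
  finally show ?thesis .
qed

section \<open>Matrices as relations\<close>

lemma card_binary_tables:
  "card (binary_tables r c) = card (incidences {..<dim_vec r} {..<dim_vec c} (($) r) (($) c))"
proof (rule bij_betw_same_card)
  let ?f = "\<lambda>A. {(i, j). i < dim_vec r \<and> j < dim_vec c \<and> A $$ (i, j) = (1 :: nat)}"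
  let ?g = "\<lambda>E. mat (dim_vec r) (dim_vec c) (\<lambda>x. if x \<in> E then 1 else 0 :: nat)"
  \<comment> \<open>For 0-1 entries a sum counts the ones; this serves rows and columns, in both
    directions of the bijection.\<close>
  have card_eq: "card {j. j < k \<and> h j = 1} = (\<Sum>j<k. h j)"
    if "\<forall>j<k. h j \<in> {0, 1}" for h :: "nat \<Rightarrow> nat" and k
  proof -
    have "(\<Sum>j<k. h j) = (\<Sum>j<k. if h j = 1 then 1 else 0)"
      using that by (intro sum.cong) auto
    also have "\<dots> = card {j. j < k \<and> h j = 1}"
      by (simp add: sum.If_cases Int_def lessThan_def)
    finally show ?thesis by simp
  qed
  show "bij_betw ?f (binary_tables r c) (incidences {..<dim_vec r} {..<dim_vec c} (($) r) (($) c))"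
  proof (rule bij_betw_byWitness[where f' = ?g])
    show "\<forall>A\<in>binary_tables r c. ?g (?f A) = A"
      by (intro ballI eq_matI) (fastforce simp: binary_tables_def)+
    show "\<forall>E\<in>incidences {..<dim_vec r} {..<dim_vec c} (($) r) (($) c). ?f (?g E) = E"
      by (fastforce simp: incidences_def split: if_splits)
    show "?f ` binary_tables r c \<subseteq> incidences {..<dim_vec r} {..<dim_vec c} (($) r) (($) c)"
    proof clarify
      fix A assume A: "A \<in> binary_tables r c"
      have 1: "?f A `` {i} = {j. j < dim_vec c \<and> A $$ (i, j) = 1}" if "i < dim_vec r" for i
        using that by auto
      have 2: "(?f A)\<inverse> `` {j} = {i. i < dim_vec r \<and> A $$ (i, j) = 1}" if "j < dim_vec c" for j
        using that by auto
      show "?f A \<in> incidences {..<dim_vec r} {..<dim_vec c} (($) r) (($) c)"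
        unfolding incidences_def
      proof (intro CollectI conjI ballI)
        fix i assume "i \<in> {..<dim_vec r}"
        then have i: "i < dim_vec r" by simp
        show "card (?f A `` {i}) = r $ i" unfolding 1[OF i]
          by (subst card_eq) (use A i in \<open>auto simp: binary_tables_def\<close>)
      next
        fix j assume "j \<in> {..<dim_vec c}"
        then have j: "j < dim_vec c" by simp
        show "card ((?f A)\<inverse> `` {j}) = c $ j" unfolding 2[OF j]
          by (subst card_eq) (use A j in \<open>auto simp: binary_tables_def\<close>)
      qed auto
    qed
    show "?g ` incidences {..<dim_vec r} {..<dim_vec c} (($) r) (($) c) \<subseteq> binary_tables r c"
    proof clarify
      fix E assume E: "E \<in> incidences {..<dim_vec r} {..<dim_vec c} (($) r) (($) c)"
      have "(\<Sum>j<dim_vec c. ?g E $$ (i, j)) = r $ i" if i: "i < dim_vec r" for i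
      proof -
        have "(\<Sum>j<dim_vec c. ?g E $$ (i, j)) = card {j. j < dim_vec c \<and> ?g E $$ (i, j) = 1}"
          by (subst card_eq) (use i in auto)
        also have "{j. j < dim_vec c \<and> ?g E $$ (i, j) = 1} = E `` {i}"
          using E i by (fastforce simp: incidences_def split: if_splits)
        finally show ?thesis using E i by (simp add: incidences_def)
      qed
      moreover have "(\<Sum>i<dim_vec r. ?g E $$ (i, j)) = c $ j" if j: "j < dim_vec c" for j
      proof -
        have "(\<Sum>i<dim_vec r. ?g E $$ (i, j)) = card {i. i < dim_vec r \<and> ?g E $$ (i, j) = 1}"
          by (subst card_eq) (use j in auto)
        also have "{i. i < dim_vec r \<and> ?g E $$ (i, j) = 1} = E\<inverse> `` {j}"
          using E j by (fastforce simp: incidences_def split: if_splits)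
        finally show ?thesis using E j by (simp add: incidences_def)
      qed
      ultimately show "?g E \<in> binary_tables r c" by (auto simp: binary_tables_def)
    qed
  qed
qed

section \<open>Binary entropy\<close>

text \<open>The terms at \<open>i\<close> and \<open>i + 1\<close> compare as
  \<open>(i + 1) * l\<close> to \<open>(k + l - i) * k\<close>, so the sequence does not decrease up
  to \<open>k\<close> and does not increase from there on.\<close>

lemma binomial_term_le_mode:
  fixes k l i :: nat
  assumes "i \<le> k + l"
  shows "((k + l) choose i) * k ^ i * l ^ (k + l - i) \<le> ((k + l) choose k) * k ^ k * l ^ l"
proof -
  define t where "t i = ((k + l) choose i) * k ^ i * l ^ (k + l - i)" for i
  have abs: "Suc i * ((k + l) choose Suc i) = (k + l - i) * ((k + l) choose i)" for i
    by (metis binomial_absorb_comp binomial_absorption)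
  \<comment> \<open>Multiplying by \<open>Suc i\<close> exposes a common factor without any
    division, so \<open>k = 0\<close> and \<open>l = 0\<close> are no special cases.\<close>
  have t1: "Suc i * t i = ((k + l) choose i) * k ^ i * l ^ (k + l - Suc i) * (l * Suc i)"
    and t2: "Suc i * t (Suc i) = ((k + l) choose i) * k ^ i * l ^ (k + l - Suc i) * ((k + l - i) * k)"
    if "i < k + l" for i
  proof -
    have "l ^ (k + l - i) = l * l ^ (k + l - Suc i)"
      using that by (metis Suc_diff_Suc power_Suc)
    then show "Suc i * t i = ((k + l) choose i) * k ^ i * l ^ (k + l - Suc i) * (l * Suc i)"
      by (simp only: t_def mult_ac)
    have "Suc i * t (Suc i) = Suc i * ((k + l) choose Suc i) * k ^ Suc i * l ^ (k + l - Suc i)"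
      by (simp only: t_def mult.assoc)
    then show "Suc i * t (Suc i) = ((k + l) choose i) * k ^ i * l ^ (k + l - Suc i) * ((k + l - i) * k)"
      by (simp only: abs power_Suc mult_ac)
  qed
  have up: "t i \<le> t (Suc i)" if "i < k" for i
  proof -
    have "Suc i * l \<le> k * (k + l - i)" using that by (intro mult_mono) auto
    then have "Suc i * t i \<le> Suc i * t (Suc i)"
      using that by (subst t1, simp, subst t2, simp, intro mult_left_mono) (auto simp: mult_ac)
    then show ?thesis by (simp only: Suc_mult_le_cancel1)
  qed
  have down: "t (Suc i) \<le> t i" if "k \<le> i" "i < k + l" for i
  proof -
    have "(k + l - i) * k \<le> l * Suc i" using that by (intro mult_mono) auto
    then have "Suc i * t (Suc i) \<le> Suc i * t i"
      using that by (subst t1, simp, subst t2, simp, intro mult_left_mono) auto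
    then show ?thesis by (simp only: Suc_mult_le_cancel1)
  qed
  have "t i \<le> t k"
  proof (cases "i \<le> k")
    case True
    then show ?thesis
      by (induction rule: inc_induct) (auto intro: order_trans[OF up])
  next
    case False
    then have "k \<le> i" by simp
    then show ?thesis using assms
      by (induction rule: dec_induct) (auto intro: order_trans[OF down])
  qed
  then show ?thesis by (simp add: t_def)
qed

text \<open>Each entropy summand exponentiates to a power of a quotient. The product form remains
  valid when \<open>k\<close> or \<open>l\<close> is 0, since then both \<open>0^0\<close> and the
  exponential factor are 1.\<close>

lemma exp_bin_entropy:
  fixes k l :: nat
  assumes "0 < k + l"
  shows "exp (real (k + l) * bin_entropy (real k / real (k + l))) * (real k ^ k * real l ^ l)
    = real (k + l) ^ (k + l)"
proof -
  have pow: "exp (real j * ln (real (k + l) / real j)) * real j ^ j = real (k + l) ^ j" for j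
  proof (cases "j = 0")
    case False
    then have "0 < real (k + l) / real j" using assms by (intro divide_pos_pos) linarith+
    then have "exp (real j * ln (real (k + l) / real j)) = (real (k + l) / real j) ^ j"
      by (simp only: exp_of_nat_mult exp_ln)
    then show ?thesis using False by (simp add: power_divide)
  qed simp
  have "real (k + l) \<noteq> 0" using assms by linarith
  then have "1 - real k / real (k + l) = real l / real (k + l)" by (simp add: field_simps)
  then have "real (k + l) * bin_entropy (real k / real (k + l))
      = real k * ln (real (k + l) / real k) + real l * ln (real (k + l) / real l)"
    using assms unfolding bin_entropy_def by (simp add: distrib_left)
  then have "exp (real (k + l) * bin_entropy (real k / real (k + l))) * (real k ^ k * real l ^ l)
      = (exp (real k * ln (real (k + l) / real k)) * real k ^ k)
        * (exp (real l * ln (real (k + l) / real l)) * real l ^ l)"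
    by (simp only: exp_add mult_ac)
  then show ?thesis by (simp only: pow power_add)
qed

text \<open>In the binomial expansion of \<open>(k + l)^N\<close> the term at \<open>k\<close> is at
  most the whole sum and, as the largest of \<open>N + 1\<close> terms, at least the sum divided by
  \<open>N + 1\<close>. By \<open>exp_bin_entropy\<close> the quotient of \<open>N^N\<close> by
  \<open>k^k * l^l\<close> is the exponential of the scaled entropy.\<close>

lemma ln_binomial_bin_entropy:
  fixes k N :: nat
  assumes "k \<le> N" "0 < N"
  shows "ln (real (N choose k)) \<le> real N * bin_entropy (real k / real N)"
    and "real N * bin_entropy (real k / real N) - ln (real N + 1) \<le> ln (real (N choose k))"
proof -
  obtain l where N: "N = k + l" using assms(1) le_Suc_ex by blast
  define P where "P = real k ^ k * real l ^ l"
  define H where "H = real N * bin_entropy (real k / real N)"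
  have P: "P > 0" unfolding P_def by (cases "k = 0"; cases "l = 0") auto
  have H: "exp H * P = real N ^ N"
    using exp_bin_entropy[of k l] assms(2) unfolding H_def P_def N by simp
  have pos: "real (N choose k) > 0" using assms(1) by simp
  let ?t = "\<lambda>i. (N choose i) * k ^ i * l ^ (N - i)"
  have total: "(\<Sum>i\<le>N. ?t i) = N ^ N" using binomial[of k l N] by (simp add: N)
  have "?t k \<le> (\<Sum>i\<le>N. ?t i)" by (rule member_le_sum) (use assms(1) in auto)
  then have "real (?t k) \<le> real (N ^ N)" unfolding total by (simp only: of_nat_le_iff)
  then have "real (N choose k) * P \<le> exp H * P"
    unfolding H by (simp add: P_def N mult.assoc)
  then have "real (N choose k) \<le> exp H" using P by simp
  then show "ln (real (N choose k)) \<le> real N * bin_entropy (real k / real N)"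
    using pos unfolding H_def[symmetric] by (metis exp_le_cancel_iff exp_ln)
  have "(\<Sum>i\<le>N. ?t i) \<le> (\<Sum>i\<le>N. ?t k)"
    by (rule sum_mono) (use binomial_term_le_mode[of _ k l] in \<open>simp add: N\<close>)
  then have "N ^ N \<le> (N + 1) * ?t k" unfolding total by simp
  then have "real (N ^ N) \<le> real ((N + 1) * ?t k)" by (simp only: of_nat_le_iff)
  then have "exp H * P \<le> ((real N + 1) * real (N choose k)) * P"
    unfolding H by (simp add: P_def N algebra_simps)
  then have "exp H \<le> (real N + 1) * real (N choose k)" using P by simp
  then have "ln (exp H) \<le> ln ((real N + 1) * real (N choose k))"
    using pos by (subst ln_le_cancel_iff) auto
  also have "\<dots> = ln (real N + 1) + ln (real (N choose k))" using pos by (subst ln_mult) auto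
  finally show "real N * bin_entropy (real k / real N) - ln (real N + 1) \<le> ln (real (N choose k))"
    by (simp add: H_def)
qed

text \<open>Concavity, derived from \<open>ln w \<le> w - 1\<close> instead of derivatives so that
  the endpoints \<open>z = 0\<close> and \<open>z = 1\<close> are covered.\<close>

lemma bin_entropy_le_tangent:
  assumes "0 \<le> z" "z \<le> 1" "0 < y" "y < 1"
  shows "bin_entropy z \<le> bin_entropy y + ln ((1 - y) / y) * (z - y)"
proof -
  \<comment> \<open>In the two uses below the corrections \<open>v - u\<close> are
    \<open>y - z\<close> and \<open>z - y\<close>, which cancel.\<close>
  have part: "u * ln (1 / u) \<le> - u * ln v + (v - u)" if "0 \<le> u" "0 < v" for u v :: real
  proof (cases "u = 0")
    case False
    then have "ln (v / u) \<le> v / u - 1" using that by (intro ln_le_minus_one) auto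
    then have "u * ln (v / u) \<le> u * (v / u - 1)" using that by (intro mult_left_mono) auto
    then show ?thesis using that False by (simp add: ln_div algebra_simps)
  qed (use that in auto)
  have "bin_entropy z \<le> - z * ln y - (1 - z) * ln (1 - y)"
    using part[of z y] part[of "1 - z" "1 - y"] assms by (simp add: bin_entropy_def algebra_simps)
  also have "\<dots> = bin_entropy y + ln ((1 - y) / y) * (z - y)"
    using assms by (simp add: bin_entropy_def ln_div algebra_simps)
  finally show ?thesis .
qed

section \<open>Taylor expansion of the entropy\<close>

text \<open>At points of distance at least \<open>e\<close> from 0 and 1 the third derivative is at
  most \<open>1 / e^2\<close> in absolute value, which controls the Lagrange remainder.\<close>

lemma bin_entropy_Taylor_cubic:
  assumes y: "0 < y" "y < 1"
  shows "\<exists>K \<epsilon>. 0 \<le> K \<and> 0 < \<epsilon> \<and> (\<forall>h. \<bar>h\<bar> \<le> \<epsilon> \<longrightarrow>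
    \<bar>bin_entropy (y + h) - bin_entropy y - ln ((1 - y) / y) * h + h\<^sup>2 / (2 * y * (1 - y))\<bar> \<le> K * \<bar>h\<bar> ^ 3)"
proof -
  \<comment> \<open>Half the distance from \<open>y\<close> to the boundary: points within
    \<open>e\<close> of \<open>y\<close> keep distance \<open>e\<close> from 0 and 1.\<close>
  define e where "e = min y (1 - y) / 2"
  have e: "0 < e" "2 * e \<le> y" "y + 2 * e \<le> 1" using y by (auto simp: e_def min_def)
  \<comment> \<open>The entropy on the open unit interval and its successive derivatives, in the
    form that \<open>Taylor\<close> expects.\<close>
  define d :: "nat \<Rightarrow> real \<Rightarrow> real" where "d m =
    (if m = 0 then (\<lambda>x. - x * ln x - (1 - x) * ln (1 - x)) else if m = 1 then (\<lambda>x. ln (1 - x) - ln x)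
     else if m = 2 then (\<lambda>x. - 1 / x - 1 / (1 - x)) else (\<lambda>x. 1 / x\<^sup>2 - 1 / (1 - x)\<^sup>2))" for m
  have ent: "bin_entropy x = d 0 x" if "0 < x" "x < 1" for x
    using that by (simp add: bin_entropy_def d_def ln_div)
  have der: "DERIV (d m) t :> d (Suc m) t" if m: "m < 3" and t: "0 < t" "t < 1" for m t
  proof -
    consider "m = 0" | "m = 1" | "m = 2" using m by linarith
    then show ?thesis
    proof cases
      case 1
      have "((\<lambda>x. - x * ln x - (1 - x) * ln (1 - x)) has_real_derivative ln (1 - t) - ln t) (at t)"
        using t by (auto intro!: derivative_eq_intros)
      then show ?thesis using 1 by (simp add: d_def)
    next
      case 2
      have "((\<lambda>x. ln (1 - x) - ln x) has_real_derivative - 1 / t - 1 / (1 - t)) (at t)"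
        using t by (auto intro!: derivative_eq_intros simp: field_simps)
      then show ?thesis using 2 by (simp add: d_def)
    next
      case 3
      have "((\<lambda>x. - 1 / x - 1 / (1 - x)) has_real_derivative 1 / t\<^sup>2 - 1 / (1 - t)\<^sup>2) (at t)"
        using t by (auto intro!: derivative_eq_intros simp: field_simps power2_eq_square)
      then show ?thesis using 3 by (simp add: d_def)
    qed
  qed
  have "\<bar>bin_entropy (y + h) - bin_entropy y - ln ((1 - y) / y) * h + h\<^sup>2 / (2 * y * (1 - y))\<bar>
      \<le> 1 / e\<^sup>2 * \<bar>h\<bar> ^ 3" if h: "\<bar>h\<bar> \<le> e" for h
  proof (cases "h = 0")
    case False
    have rng: "0 < y + h" "y + h < 1" using h e by (auto simp: abs_le_iff)
    have "\<exists>t. (if y + h < y then y + h < t \<and> t < y else y < t \<and> t < y + h) \<and>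
      d 0 (y + h) = (\<Sum>m<3. d m y / fact m * (y + h - y) ^ m) + d 3 t / fact 3 * (y + h - y) ^ 3"
      by (rule Taylor[where a = "y - e" and b = "y + e"])
        (use h e False in \<open>auto intro!: der simp: abs_le_iff\<close>)
    then obtain t where t: "if y + h < y then y + h < t \<and> t < y else y < t \<and> t < y + h"
      and eq: "d 0 (y + h) = (\<Sum>m<3. d m y / fact m * h ^ m) + d 3 t / fact 3 * h ^ 3"
      by auto
    have te: "e \<le> t" "e \<le> 1 - t" using t h e by (auto simp: abs_le_iff split: if_splits)
    have sq: "1 / s\<^sup>2 \<le> 1 / e\<^sup>2" "0 \<le> 1 / s\<^sup>2" if "e \<le> s" for s
      using that e by (auto intro!: divide_left_mono power_mono mult_pos_pos)
    have d3: "\<bar>d 3 t\<bar> \<le> 1 / e\<^sup>2"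
    proof -
      have "d 3 t = 1 / t\<^sup>2 - 1 / (1 - t)\<^sup>2" by (simp add: d_def)
      then show ?thesis using sq[OF te(1)] sq[OF te(2)] by linarith
    qed
    have "d 2 y = - 1 / (y * (1 - y))" using y by (simp add: d_def field_simps)
    then have d2: "d 2 y / 2 * h\<^sup>2 = - (h\<^sup>2 / (2 * y * (1 - y)))" by simp
    have d1: "d 1 y = ln ((1 - y) / y)" using y by (simp add: d_def ln_div)
    have "(\<Sum>m<3. d m y / fact m * h ^ m) = d 0 y + d 1 y * h + d 2 y / 2 * h\<^sup>2"
      by (simp add: eval_nat_numeral)
    moreover have "fact 3 = (6 :: real)" by (simp add: fact_numeral)
    ultimately have "d 0 (y + h) - d 0 y - ln ((1 - y) / y) * h + h\<^sup>2 / (2 * y * (1 - y)) = d 3 t / 6 * h ^ 3"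
      using eq d1 d2 by simp
    then have "bin_entropy (y + h) - bin_entropy y - ln ((1 - y) / y) * h + h\<^sup>2 / (2 * y * (1 - y))
        = d 3 t / 6 * h ^ 3"
      using ent rng y by simp
    then have "\<bar>bin_entropy (y + h) - bin_entropy y - ln ((1 - y) / y) * h + h\<^sup>2 / (2 * y * (1 - y))\<bar>
        = \<bar>d 3 t / 6 * h ^ 3\<bar>"
      by (rule arg_cong)
    also have "\<dots> = \<bar>d 3 t\<bar> / 6 * \<bar>h\<bar> ^ 3" by (simp add: abs_mult power_abs)
    also have "\<dots> \<le> 1 / e\<^sup>2 * \<bar>h\<bar> ^ 3"
      using d3 by (intro mult_right_mono) auto
    finally show ?thesis .
  qed simp
  then show ?thesis using e by (intro exI[of _ "1 / e\<^sup>2"] exI[of _ e]) auto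
qed

text \<open>The quadratic term of the cubic expansion joins the error, and
  \<open>\<bar>h\<bar> ^ 3\<close> is at most \<open>e * h^2\<close>.\<close>

lemma bin_entropy_Taylor_quadratic:
  assumes y: "0 < y" "y < 1"
  shows "\<exists>K \<epsilon>. 0 \<le> K \<and> 0 < \<epsilon> \<and> (\<forall>h. \<bar>h\<bar> \<le> \<epsilon> \<longrightarrow>
    \<bar>bin_entropy (y + h) - bin_entropy y - ln ((1 - y) / y) * h\<bar> \<le> K * h\<^sup>2)"
proof -
  obtain K e where K: "0 \<le> K" "0 < e" and bound: "\<And>h. \<bar>h\<bar> \<le> e \<Longrightarrow>
    \<bar>bin_entropy (y + h) - bin_entropy y - ln ((1 - y) / y) * h + h\<^sup>2 / (2 * y * (1 - y))\<bar> \<le> K * \<bar>h\<bar> ^ 3"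
    using bin_entropy_Taylor_cubic[OF y] by blast
  define c where "c = 1 / (2 * y * (1 - y))"
  have c: "0 \<le> c" using y by (simp add: c_def)
  have "\<bar>bin_entropy (y + h) - bin_entropy y - ln ((1 - y) / y) * h\<bar> \<le> (K * e + c) * h\<^sup>2"
    if h: "\<bar>h\<bar> \<le> e" for h
  proof -
    have "K * \<bar>h\<bar> ^ 3 = K * \<bar>h\<bar> * h\<^sup>2" by (simp add: power3_eq_cube power2_eq_square)
    also have "\<dots> \<le> K * e * h\<^sup>2" using h K by (intro mult_right_mono mult_left_mono) auto
    finally have "\<bar>bin_entropy (y + h) - bin_entropy y - ln ((1 - y) / y) * h + c * h\<^sup>2\<bar> \<le> K * e * h\<^sup>2"
      using bound[OF h] by (simp add: c_def)
    moreover have "0 \<le> c * h\<^sup>2" using c by simp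
    ultimately show ?thesis unfolding distrib_right by linarith
  qed
  then show ?thesis using K c by (intro exI[of _ "K * e + c"] exI[of _ e]) auto
qed

text \<open>
  Here \<open>M\<close> and \<open>x\<close> are the sizes of the two blocks, \<open>s\<close> and \<open>t\<close> the rounding errors of the margins
  \<open>\<lfloor>ax\<rfloor>\<close> and \<open>\<lfloor>Cx\<rfloor>\<close>, and \<open>z\<close> the density of the small corner block.
\<close>

lemma block_entropy_expansion:
  fixes a C :: real
  assumes a: "0 < a" "a < 1" and C: "0 < C" "C < 1"
  shows "\<exists>K \<eta>. 0 < \<eta> \<and> (\<forall>x M s t z. 1 \<le> M \<and> M \<le> x \<and> M \<le> \<eta> * x \<and>
      0 \<le> s \<and> s \<le> 1 \<and> 0 \<le> t \<and> t \<le> 1 \<and> 0 \<le> z \<and> z \<le> 1 \<longrightarrow>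
    \<bar>2 * (M * x) * bin_entropy (a - (s + z * M) / x)
      + x\<^sup>2 * bin_entropy (C - (a * M + t) / x + (s * M + z * M\<^sup>2) / x\<^sup>2)
      - (bin_entropy C * x\<^sup>2 + (2 * bin_entropy a - a * ln ((1 - C) / C)) * (x * M)
         + (z * (ln ((1 - C) / C) - 2 * ln ((1 - a) / a)) - a\<^sup>2 / (2 * C * (1 - C))) * M\<^sup>2)\<bar>
    \<le> K * (M ^ 3 / x + x))"
proof -
  obtain K1 e1 where K1: "0 \<le> K1" "0 < e1" and T1: "\<And>h. \<bar>h\<bar> \<le> e1 \<Longrightarrow>
    \<bar>bin_entropy (a + h) - bin_entropy a - ln ((1 - a) / a) * h\<bar> \<le> K1 * h\<^sup>2"
    using bin_entropy_Taylor_quadratic[OF a] by blast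
  obtain K2 e2 where K2: "0 \<le> K2" "0 < e2" and T2: "\<And>h. \<bar>h\<bar> \<le> e2 \<Longrightarrow>
    \<bar>bin_entropy (C + h) - bin_entropy C - ln ((1 - C) / C) * h + h\<^sup>2 / (2 * C * (1 - C))\<bar> \<le> K2 * \<bar>h\<bar> ^ 3"
    using bin_entropy_Taylor_cubic[OF C] by blast
  define La where "La = ln ((1 - a) / a)"
  define LC where "LC = ln ((1 - C) / C)"
  define c where "c = 1 / (2 * C * (1 - C))"
  \<comment> \<open>Keeps the two displacements, at most \<open>2 * M / x\<close> and
    \<open>4 * M / x\<close>, within the ranges \<open>e1\<close> and \<open>e2\<close>.\<close>
  define \<eta> where "\<eta> = min (e1 / 2) (e2 / 4)"
  \<comment> \<open>The summands are the constants of the bounds \<open>F1\<close> to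
    \<open>F5\<close>.\<close>
  define K where "K = 8 * K1 + 64 * K2 + 4 * c + 2 * \<bar>La\<bar> + \<bar>LC\<bar>"
  have c: "0 < c" using C by (simp add: c_def)
  have "\<bar>2 * (M * x) * bin_entropy (a - (s + z * M) / x)
      + x\<^sup>2 * bin_entropy (C - (a * M + t) / x + (s * M + z * M\<^sup>2) / x\<^sup>2)
      - (bin_entropy C * x\<^sup>2 + (2 * bin_entropy a - a * LC) * (x * M)
         + (z * (LC - 2 * La) - a\<^sup>2 / (2 * C * (1 - C))) * M\<^sup>2)\<bar>
    \<le> K * (M ^ 3 / x + x)"
    if M: "1 \<le> M" "M \<le> x" "M \<le> \<eta> * x" and s: "0 \<le> s" "s \<le> 1" and t: "0 \<le> t" "t \<le> 1"
      and z: "0 \<le> z" "z \<le> 1" for x M s t z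
  proof -
    have x: "1 \<le> x" using M by linarith
    have zM: "0 \<le> z * M" "z * M \<le> M" using z M by (auto intro: mult_left_le_one_le)
    have aM: "0 \<le> a * M" "a * M \<le> M" using a M by (auto intro: mult_left_le_one_le)
    have sM: "0 \<le> s * M" "s * M \<le> M" using s M by (auto intro: mult_left_le_one_le)
    have tx: "0 \<le> t * x" "t * x \<le> x" using t x by (auto intro: mult_left_le_one_le)
    have zM2: "0 \<le> z * M\<^sup>2" "z * M\<^sup>2 \<le> M\<^sup>2" using z by (auto intro: mult_left_le_one_le)
    have M2x: "M\<^sup>2 / x \<le> M"
      using M x by (simp add: power2_eq_square divide_le_eq mult_left_mono)
    have "\<eta> * x \<le> e1 / 2 * x" "\<eta> * x \<le> e2 / 4 * x"
      using x by (intro mult_right_mono; simp add: \<eta>_def)+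
    then have Me: "M \<le> e1 / 2 * x" "M \<le> e2 / 4 * x" using M(3) by linarith+
    \<comment> \<open>\<open>h\<close> and \<open>u / x\<close> are the displacements of the two
      densities from \<open>a\<close> and \<open>C\<close>; \<open>v\<close> is what remains of
      \<open>u\<close> beside its leading part \<open>- a * M\<close>.\<close>
    define h where "h = - ((s + z * M) / x)"
    define u where "u = - (a * M + t) + (s * M + z * M\<^sup>2) / x"
    define E1 where "E1 = bin_entropy (a + h) - bin_entropy a - La * h"
    define E2 where "E2 = bin_entropy (C + u / x) - bin_entropy C - LC * (u / x) + c * (u / x)\<^sup>2"
    define v where "v = - t + (s * M + z * M\<^sup>2) / x"
    have hb: "\<bar>h\<bar> \<le> 2 * M / x"
    proof -
      have "\<bar>h\<bar> = (s + z * M) / x" using zM(1) s x by (simp add: h_def abs_divide)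
      also have "\<dots> \<le> 2 * M / x" by (rule divide_right_mono) (use zM s M x in linarith)+
      finally show ?thesis .
    qed
    have "2 * M / x \<le> e1" using Me(1) x by (simp add: divide_le_eq)
    with hb have "\<bar>E1\<bar> \<le> K1 * h\<^sup>2" unfolding E1_def La_def by (intro T1) linarith
    also have "\<dots> \<le> K1 * (2 * M / x)\<^sup>2"
      using hb K1 power_mono[OF hb, of 2] by (intro mult_left_mono) auto
    finally have E1: "\<bar>E1\<bar> \<le> K1 * (2 * M / x)\<^sup>2" .
    have "\<bar>2 * (M * x) * E1\<bar> = 2 * (M * x) * \<bar>E1\<bar>" using M x by (simp add: abs_mult)
    also have "\<dots> \<le> 2 * (M * x) * (K1 * (2 * M / x)\<^sup>2)"
      using E1 M x by (intro mult_left_mono) auto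
    also have "\<dots> = 8 * K1 * (M ^ 3 / x)" using x by (simp add: field_simps power2_eq_square power3_eq_cube)
    finally have F1: "\<bar>2 * (M * x) * E1\<bar> \<le> 8 * K1 * (M ^ 3 / x)" .
    have w: "0 \<le> (s * M + z * M\<^sup>2) / x" "(s * M + z * M\<^sup>2) / x \<le> 1 + M\<^sup>2 / x"
    proof -
      have "(s * M + z * M\<^sup>2) / x \<le> (x + M\<^sup>2) / x"
        by (rule divide_right_mono) (use sM zM2 M x in linarith)+
      then show "(s * M + z * M\<^sup>2) / x \<le> 1 + M\<^sup>2 / x" using x by (simp add: add_divide_distrib)
    qed (use sM zM2 x in auto)
    have vb: "\<bar>v\<bar> \<le> 1 + M\<^sup>2 / x"
    proof -
      have "0 \<le> M\<^sup>2 / x" using x by simp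
      then show ?thesis unfolding v_def using w t by linarith
    qed
    have u: "u = v - a * M" by (simp add: u_def v_def)
    have ub: "\<bar>u\<bar> \<le> 4 * M" using vb M2x aM M unfolding u by linarith
    have uxb: "\<bar>u / x\<bar> \<le> 4 * M / x" using ub x by (simp add: abs_divide divide_right_mono)
    have "4 * M / x \<le> e2" using Me(2) x by (simp add: divide_le_eq)
    with uxb have "\<bar>E2\<bar> \<le> K2 * \<bar>u / x\<bar> ^ 3"
      unfolding E2_def LC_def c_def using T2[of "u / x"] by simp
    also have "\<dots> \<le> K2 * (4 * M / x) ^ 3"
      using uxb K2 by (intro mult_left_mono power_mono) auto
    finally have E2: "\<bar>E2\<bar> \<le> K2 * (4 * M / x) ^ 3" .
    have "\<bar>x\<^sup>2 * E2\<bar> = x\<^sup>2 * \<bar>E2\<bar>" by (simp add: abs_mult)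
    also have "\<dots> \<le> x\<^sup>2 * (K2 * (4 * M / x) ^ 3)" using E2 by (intro mult_left_mono) auto
    also have "\<dots> = 64 * K2 * (M ^ 3 / x)" using x by (simp add: field_simps power2_eq_square power3_eq_cube)
    finally have F2: "\<bar>x\<^sup>2 * E2\<bar> \<le> 64 * K2 * (M ^ 3 / x)" .
    have "\<bar>v - 2 * (a * M)\<bar> \<le> 4 * M" using vb M2x aM M by linarith
    \<comment> \<open>This product is the difference of \<open>u^2\<close> and
      \<open>a^2 * M^2\<close>; it is of order \<open>M + M^3 / x\<close>.\<close>
    have "\<bar>v * (v - 2 * (a * M))\<bar> = \<bar>v\<bar> * \<bar>v - 2 * (a * M)\<bar>" by (rule abs_mult)
    also have "\<dots> \<le> (1 + M\<^sup>2 / x) * (4 * M)"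
      using vb \<open>\<bar>v - 2 * (a * M)\<bar> \<le> 4 * M\<close> by (rule mult_mono) (use x in auto)
    also have "\<dots> = 4 * M + 4 * (M ^ 3 / x)"
      by (simp add: field_simps power2_eq_square power3_eq_cube)
    finally have "\<bar>v * (v - 2 * (a * M))\<bar> \<le> 4 * (M ^ 3 / x + x)" using M by simp
    then have "c * \<bar>v * (v - 2 * (a * M))\<bar> \<le> c * (4 * (M ^ 3 / x + x))" using c by (intro mult_left_mono) auto
    then have F3: "\<bar>c * (v * (v - 2 * (a * M)))\<bar> \<le> 4 * c * (M ^ 3 / x + x)" using c by (simp add: abs_mult)
    have sMb: "\<bar>M * s\<bar> \<le> x" using sM M unfolding mult.commute[of M s] by linarith
    have F4: "\<bar>2 * La * (M * s)\<bar> \<le> 2 * \<bar>La\<bar> * x"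
      using mult_left_mono[OF sMb, of "2 * \<bar>La\<bar>"] by (simp add: abs_mult)
    have stb: "\<bar>s * M - t * x\<bar> \<le> x" using sM tx M by linarith
    have F5: "\<bar>LC * (s * M - t * x)\<bar> \<le> \<bar>LC\<bar> * x"
      using mult_left_mono[OF stb, of "\<bar>LC\<bar>"] by (simp add: abs_mult)
    have xne: "x \<noteq> 0" using x by simp
    have arg1: "a - (s + z * M) / x = a + h" by (simp add: h_def)
    have arg2: "C - (a * M + t) / x + (s * M + z * M\<^sup>2) / x\<^sup>2 = C + u / x"
      using xne by (simp add: u_def field_simps power2_eq_square)
    \<comment> \<open>The linear terms here and in \<open>G2\<close> combine to the coefficient
      \<open>LC - 2 * La\<close> of \<open>z * M^2\<close>.\<close>
    have G1: "2 * (M * x) * bin_entropy (a + h)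
      = 2 * (M * x) * E1 + 2 * (M * x) * bin_entropy a - 2 * La * (M * s) - 2 * La * z * M\<^sup>2"
      unfolding E1_def h_def using xne by (simp add: field_simps power2_eq_square)
    have xu: "x\<^sup>2 * (u / x) = - a * (x * M) - t * x + s * M + z * M\<^sup>2"
      using xne by (simp add: u_def field_simps power2_eq_square)
    have xu2: "x\<^sup>2 * (u / x)\<^sup>2 = v * (v - 2 * (a * M)) + a\<^sup>2 * M\<^sup>2"
    proof -
      have "x\<^sup>2 * (u / x)\<^sup>2 = u\<^sup>2" using xne by (simp add: power_divide)
      then show ?thesis by (simp add: u power2_eq_square algebra_simps)
    qed
    have "x\<^sup>2 * bin_entropy (C + u / x)
      = x\<^sup>2 * E2 + x\<^sup>2 * bin_entropy C + LC * (x\<^sup>2 * (u / x)) - c * (x\<^sup>2 * (u / x)\<^sup>2)"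
      unfolding E2_def by (simp add: algebra_simps)
    then have G2: "x\<^sup>2 * bin_entropy (C + u / x)
      = x\<^sup>2 * E2 + x\<^sup>2 * bin_entropy C + LC * (- a * (x * M) - t * x + s * M + z * M\<^sup>2)
        - c * (v * (v - 2 * (a * M)) + a\<^sup>2 * M\<^sup>2)"
      unfolding xu xu2 .
    have cc: "a\<^sup>2 / (2 * C * (1 - C)) = c * a\<^sup>2" by (simp add: c_def)
    have "2 * (M * x) * bin_entropy (a + h) + x\<^sup>2 * bin_entropy (C + u / x)
      - (bin_entropy C * x\<^sup>2 + (2 * bin_entropy a - a * LC) * (x * M)
         + (z * (LC - 2 * La) - c * a\<^sup>2) * M\<^sup>2)
      = 2 * (M * x) * E1 + x\<^sup>2 * E2 - 2 * La * (M * s) + LC * (s * M - t * x)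
        - c * (v * (v - 2 * (a * M)))"
      unfolding G1 G2 by (simp add: algebra_simps)
    also have "\<bar>\<dots>\<bar> \<le> 8 * K1 * (M ^ 3 / x) + 64 * K2 * (M ^ 3 / x) + 2 * \<bar>La\<bar> * x + \<bar>LC\<bar> * x
        + 4 * c * (M ^ 3 / x + x)"
      using F1 F2 F3 F4 F5 by linarith
    also have "\<dots> \<le> K * (M ^ 3 / x + x)"
    proof -
      have M3: "0 \<le> M ^ 3 / x" using M x by simp
      have "0 \<le> 8 * K1 * x" "0 \<le> 64 * K2 * x" "0 \<le> 2 * \<bar>La\<bar> * (M ^ 3 / x)" "0 \<le> \<bar>LC\<bar> * (M ^ 3 / x)"
        using K1 K2 x M3 by (intro mult_nonneg_nonneg; simp)+
      then show ?thesis unfolding K_def distrib_left distrib_right by linarith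
    qed
    finally show ?thesis unfolding arg1 arg2 cc .
  qed
  moreover have "0 < \<eta>" using K1 K2 by (simp add: \<eta>_def)
  ultimately show ?thesis unfolding La_def LC_def by blast
qed

section \<open>Logarithmic asymptotics\<close>

text \<open>The count is a product of binomials, so its logarithm is a sum of entropies up to one
  logarithmic loss per binomial; the squared factor explains the coefficient 2.\<close>

lemma ln_card_block_incidences:
  fixes k p q :: nat
  assumes fin: "finite V" "finite W" and disj: "V \<inter> W = {}"
    and pos: "0 < card V" "0 < card W"
    and le: "k \<le> (card V)\<^sup>2" "p \<le> card V * card W" "q \<le> (card W)\<^sup>2"
  defines "M \<equiv> real (card V)" and "x \<equiv> real (card W)"
  defines "G \<equiv> M\<^sup>2 * bin_entropy (real k / M\<^sup>2) + 2 * (M * x) * bin_entropy (real p / (M * x))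
      + x\<^sup>2 * bin_entropy (real q / x\<^sup>2)"
  shows "0 < card (block_incidences V W k p q)"
    and "ln (real (card (block_incidences V W k p q))) \<le> G"
    and "G - (ln (M\<^sup>2 + 1) + 2 * ln (M * x + 1) + ln (x\<^sup>2 + 1))
      \<le> ln (real (card (block_incidences V W k p q)))"
proof -
  let ?A = "real ((card V)\<^sup>2 choose k)" and ?B = "real ((card V * card W) choose p)"
    and ?D = "real ((card W)\<^sup>2 choose q)"
  have cp: "0 < ?A" "0 < ?B" "0 < ?D" using le by auto
  have eq: "real (card (block_incidences V W k p q)) = ?A * ?B\<^sup>2 * ?D"
    by (simp add: card_block_incidences[OF fin disj])
  then have "0 < real (card (block_incidences V W k p q))" using cp by simp
  then show "0 < card (block_incidences V W k p q)" by simp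
  have ln: "ln (real (card (block_incidences V W k p q))) = ln ?A + 2 * ln ?B + ln ?D"
    unfolding eq using cp by (simp add: ln_mult ln_realpow)
  have p0: "0 < (card V)\<^sup>2" "0 < card V * card W" "0 < (card W)\<^sup>2" using pos by auto
  note b = ln_binomial_bin_entropy[OF le(1) p0(1)] ln_binomial_bin_entropy[OF le(2) p0(2)]
    ln_binomial_bin_entropy[OF le(3) p0(3)]
  have M: "real ((card V)\<^sup>2) = M\<^sup>2" "real (card V * card W) = M * x" "real ((card W)\<^sup>2) = x\<^sup>2"
    by (simp_all add: M_def x_def)
  show "ln (real (card (block_incidences V W k p q))) \<le> G"
    unfolding ln G_def using b(1,3,5) unfolding M by linarith
  show "G - (ln (M\<^sup>2 + 1) + 2 * ln (M * x + 1) + ln (x\<^sup>2 + 1))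
      \<le> ln (real (card (block_incidences V W k p q)))"
    unfolding ln G_def using b(2,4,6) unfolding M by linarith
qed

text \<open>By \<open>crit\<close>, the total entropy at corner density \<open>z\<close> is the main
  term plus \<open>M^2\<close> times the gap between the entropy at \<open>z\<close> and its tangent
  at \<open>y\<close>, up to errors. The gap is never positive, which gives the upper bound; taking
  \<open>z\<close> within rounding of \<open>y\<close> makes it negligible, which gives the lower
  bound.\<close>

lemma ln_card_two_block_incidences:
  fixes a C y :: real
  assumes a: "0 < a" "a < 1" and C: "0 < C" "C < 1" and y: "0 < y" "y < 1"
    and crit: "ln ((1 - y) / y) = 2 * ln ((1 - a) / a) - ln ((1 - C) / C)"
  shows "\<exists>K \<eta>. 0 \<le> K \<and> 0 < \<eta> \<and> (\<forall>(V :: nat set) W R S M x. finite V \<and> finite W \<and> V \<inter> W = {} \<and>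
      M = real (card V) \<and> x = real (card W) \<and> 1 \<le> \<eta> * M \<and> M \<le> \<eta> * x \<and>
      real R \<le> a * x \<and> a * x \<le> real R + 1 \<and> real S \<le> C * x \<and> C * x \<le> real S + 1 \<longrightarrow>
    \<bar>ln (real (card (incidences (V \<union> W) (V \<union> W) (\<lambda>i. if i \<in> V then R else S)
        (\<lambda>i. if i \<in> V then R else S))))
      - (bin_entropy C * x\<^sup>2 + (2 * bin_entropy a - a * ln ((1 - C) / C)) * (x * M)
         + (bin_entropy y - y * ln ((1 - y) / y) - a\<^sup>2 / (2 * C * (1 - C))) * M\<^sup>2)\<bar>
    \<le> K * (M ^ 3 / x + x) + 12 * x * ln (2 * x + 1))"
proof -
  define LC where "LC = ln ((1 - C) / C)"
  define La where "La = ln ((1 - a) / a)"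
  define Ly where "Ly = ln ((1 - y) / y)"
  define c where "c = a\<^sup>2 / (2 * C * (1 - C))"
  have Ly: "Ly = 2 * La - LC" using crit by (simp add: Ly_def La_def LC_def)
  obtain K1 e1 where e1: "0 < e1" and T1: "\<And>x M s t z. 1 \<le> M \<Longrightarrow> M \<le> x \<Longrightarrow> M \<le> e1 * x \<Longrightarrow>
      0 \<le> s \<Longrightarrow> s \<le> 1 \<Longrightarrow> 0 \<le> t \<Longrightarrow> t \<le> 1 \<Longrightarrow> 0 \<le> z \<Longrightarrow> z \<le> 1 \<Longrightarrow>
    \<bar>2 * (M * x) * bin_entropy (a - (s + z * M) / x)
      + x\<^sup>2 * bin_entropy (C - (a * M + t) / x + (s * M + z * M\<^sup>2) / x\<^sup>2)
      - (bin_entropy C * x\<^sup>2 + (2 * bin_entropy a - a * LC) * (x * M)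
         + (z * (LC - 2 * La) - c) * M\<^sup>2)\<bar>
    \<le> K1 * (M ^ 3 / x + x)"
    using block_entropy_expansion[OF a C] unfolding LC_def La_def c_def by blast
  obtain K2 e2 where K2: "0 \<le> K2" "0 < e2" and T2: "\<And>h. \<bar>h\<bar> \<le> e2 \<Longrightarrow>
    \<bar>bin_entropy (y + h) - bin_entropy y - Ly * h\<bar> \<le> K2 * h\<^sup>2"
    using bin_entropy_Taylor_quadratic[OF y] unfolding Ly_def by blast
  \<comment> \<open>In turn these entries give \<open>1 \<le> M\<close> and
    \<open>M \<le> x\<close>, the validity of the two expansions, and \<open>M \<le> R\<close> and
    \<open>M \<le> S\<close>, which make the choice of \<open>p\<close> and \<open>q\<close>
    possible.\<close>
  define \<eta> where "\<eta> = Min {1, e1, e2, a / 2, C / 2}"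
  have \<eta>: "0 < \<eta>" "\<eta> \<le> 1" "\<eta> \<le> e1" "\<eta> \<le> e2" "\<eta> \<le> a / 2" "\<eta> \<le> C / 2"
    using e1 K2 a C by (auto simp: \<eta>_def)
  define K where "K = \<bar>K1\<bar> + K2"
  have "\<bar>ln (real (card (incidences (V \<union> W) (V \<union> W) (\<lambda>i. if i \<in> V then R else S)
        (\<lambda>i. if i \<in> V then R else S))))
      - (bin_entropy C * x\<^sup>2 + (2 * bin_entropy a - a * LC) * (x * M)
         + (bin_entropy y - y * Ly - c) * M\<^sup>2)\<bar>
    \<le> K * (M ^ 3 / x + x) + 12 * x * ln (2 * x + 1)"
    if fin: "finite V" "finite W" and disj: "V \<inter> W = {}"
      and M: "M = real (card V)" and x: "x = real (card W)" and \<eta>M: "1 \<le> \<eta> * M" "M \<le> \<eta> * x"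
      and R: "real R \<le> a * x" "a * x \<le> real R + 1" and S: "real S \<le> C * x" "C * x \<le> real S + 1"
    for V W :: "nat set" and R S and M x
  proof -
    let ?I = "incidences (V \<union> W) (V \<union> W) (\<lambda>i. if i \<in> V then R else S) (\<lambda>i. if i \<in> V then R else S)"
    let ?err = "\<bar>K1\<bar> * (M ^ 3 / x + x)"
    define \<Phi> where "\<Phi> = bin_entropy C * x\<^sup>2 + (2 * bin_entropy a - a * LC) * (x * M)
         + (bin_entropy y - y * Ly - c) * M\<^sup>2"
    have M0: "0 \<le> M" "0 \<le> x" by (simp_all add: M x)
    have le1: "\<eta> * M \<le> M" "\<eta> * x \<le> x" using \<eta> M0 by (auto intro: mult_left_le_one_le)
    have M1: "1 \<le> M" and Mx: "M \<le> x" using le1 \<eta>M by linarith+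
    have x1: "1 \<le> x" using M1 Mx by linarith
    have small: "M \<le> u * x" if "\<eta> \<le> u" for u
      using \<eta>M mult_right_mono[OF that M0(2)] by linarith
    have cV: "0 < card V" and cW: "0 < card W" using M1 x1 M x by auto
    define s where "s = a * x - real R"
    define t where "t = C * x - real S"
    have s: "0 \<le> s" "s \<le> 1" and t: "0 \<le> t" "t \<le> 1" using R S by (auto simp: s_def t_def)
    have err0: "0 \<le> M ^ 3 / x + x" using M0 by simp
    have "K1 * (M ^ 3 / x + x) \<le> ?err" using err0 by (intro mult_right_mono) auto
    then have G: "\<bar>M\<^sup>2 * bin_entropy (real k / M\<^sup>2) + 2 * (M * x) * bin_entropy (real p / (M * x))
          + x\<^sup>2 * bin_entropy (real q / x\<^sup>2)
        - (\<Phi> + (bin_entropy (real k / M\<^sup>2) - bin_entropy y - Ly * (real k / M\<^sup>2 - y)) * M\<^sup>2)\<bar> \<le> ?err"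
      if kpq: "k + p = card V * R" "p + q = card W * S" "k \<le> (card V)\<^sup>2" for k p q
    proof -
      define z where "z = real k / M\<^sup>2"
      have k: "real k = z * M\<^sup>2" using M1 by (simp add: z_def)
      have "real k \<le> real ((card V)\<^sup>2)" using kpq(3) by (simp only: of_nat_le_iff)
      then have z: "0 \<le> z" "z \<le> 1" using M1 by (auto simp: z_def M)
      have "real (k + p) = real (card V * R)" "real (p + q) = real (card W * S)"
        using kpq(1,2) by simp_all
      then have p: "real p = M * (a * x - s) - z * M\<^sup>2"
        and q: "real q = x * (C * x - t) - M * (a * x - s) + z * M\<^sup>2"
        using k by (simp_all add: M x s_def t_def)
      have pe: "real p / (M * x) = a - (s + z * M) / x"
        unfolding p using M1 x1 by (simp add: field_simps power2_eq_square)
      have qe: "real q / x\<^sup>2 = C - (a * M + t) / x + (s * M + z * M\<^sup>2) / x\<^sup>2"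
        unfolding q using x1 by (simp add: field_simps power2_eq_square)
      \<comment> \<open>The terms at \<open>y\<close> cancel, and \<open>- Ly = LC - 2 * La\<close>
        turns the slope of the tangent into the coefficient of \<open>z\<close>.\<close>
      have "\<Phi> + (bin_entropy z - bin_entropy y - Ly * (z - y)) * M\<^sup>2
        = M\<^sup>2 * bin_entropy z + (bin_entropy C * x\<^sup>2 + (2 * bin_entropy a - a * LC) * (x * M)
         + (z * (LC - 2 * La) - c) * M\<^sup>2)"
        unfolding \<Phi>_def Ly by (simp add: algebra_simps)
      then show ?thesis
        using T1[OF M1 Mx small[OF \<eta>(3)] s t z] \<open>K1 * (M ^ 3 / x + x) \<le> ?err\<close>
        unfolding pe qe z_def[symmetric] by linarith
    qed
    have lnx: "0 \<le> ln (2 * x + 1)" using x1 by simp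
    have lnle: "ln (u + 1) \<le> 2 * x * ln (2 * x + 1)" if "0 \<le> u" "u \<le> x\<^sup>2" for u
    proof -
      have "ln (u + 1) \<le> ln ((2 * x + 1)\<^sup>2)"
        using that x1 by (subst ln_le_cancel_iff) (auto simp: power2_sum intro: add_nonneg_pos)
      also have "\<dots> = 2 * ln (2 * x + 1)" using x1 by (simp add: ln_realpow)
      also have "\<dots> \<le> 2 * x * ln (2 * x + 1)" using x1 lnx by (intro mult_right_mono) auto
      finally show ?thesis .
    qed
    have sq: "M\<^sup>2 \<le> x\<^sup>2" "M * x \<le> x\<^sup>2" using Mx M0 by (auto simp: power2_eq_square intro: mult_mono)
    have upper: "real (card ?I) \<le> (M\<^sup>2 + 1) * exp (\<Phi> + ?err)"
      unfolding M
    proof (rule card_two_block_incidences_le[OF fin disj])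
      fix k p q assume kpq: "k + p = card V * R" "p + q = card W * S" "k \<le> (card V)\<^sup>2"
        "p \<le> card V * card W" "q \<le> (card W)\<^sup>2"
      have "real k \<le> real ((card V)\<^sup>2)" using kpq(3) by (simp only: of_nat_le_iff)
      then have "0 \<le> real k / M\<^sup>2" "real k / M\<^sup>2 \<le> 1" using M1 by (auto simp: M)
      then have "bin_entropy (real k / M\<^sup>2) - bin_entropy y - Ly * (real k / M\<^sup>2 - y) \<le> 0"
        using bin_entropy_le_tangent[of "real k / M\<^sup>2" y] y unfolding Ly_def by simp
      then have "(bin_entropy (real k / M\<^sup>2) - bin_entropy y - Ly * (real k / M\<^sup>2 - y)) * M\<^sup>2 \<le> 0"
        by (intro mult_nonpos_nonneg) auto
      then have "ln (real (card (block_incidences V W k p q))) \<le> \<Phi> + ?err"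
        using ln_card_block_incidences(2)[OF fin disj cV cW kpq(3-5)] G[OF kpq(1-3)]
        unfolding M[symmetric] x[symmetric] by linarith
      then show "real (card (block_incidences V W k p q)) \<le> exp (\<Phi> + \<bar>K1\<bar> * (real (card V) ^ 3 / x + x))"
        using ln_card_block_incidences(1)[OF fin disj cV cW kpq(3-5)]
        unfolding M[symmetric] by (metis exp_le_cancel_iff exp_ln of_nat_0_less_iff)
    qed simp
    \<comment> \<open>The rounded maximiser; the lower bound uses this single corner total.\<close>
    define k where "k = nat \<lfloor>y * M\<^sup>2\<rfloor>"
    have yM: "0 \<le> y * M\<^sup>2" "y * M\<^sup>2 \<le> M\<^sup>2" using y by (auto intro: mult_left_le_one_le)
    have k: "real k \<le> y * M\<^sup>2" "y * M\<^sup>2 < real k + 1" using yM(1) unfolding k_def by linarith+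
    have km: "k \<le> (card V)\<^sup>2"
    proof -
      have "real ((card V)\<^sup>2) = M\<^sup>2" by (simp add: M)
      then have "real k \<le> real ((card V)\<^sup>2)" using k yM by linarith
      then show ?thesis by (simp only: of_nat_le_iff)
    qed
    \<comment> \<open>Since \<open>a * x\<close> is at least \<open>2 * M\<close>, rounding down
      still leaves \<open>M\<close>. Hence \<open>k \<le> M^2 \<le> M * R\<close>, and the natural
      subtraction defining \<open>p\<close> is exact.\<close>
    have MR: "M \<le> real R"
    proof -
      have "M \<le> a / 2 * x" by (rule small[OF \<eta>(5)])
      then show ?thesis using R(2) M1 by linarith
    qed
    then have "card V \<le> R" by (simp add: M)
    then have kR: "k \<le> card V * R" using km
      by (metis le_trans mult_le_mono2 power2_eq_square)
    define p where "p = card V * R - k"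
    have p: "k + p = card V * R" using kR by (simp add: p_def)
    have Rn: "R \<le> card W" and Sn: "S \<le> card W"
    proof -
      have "a * x \<le> x" "C * x \<le> x" using a C M0 by (auto intro: mult_left_le_one_le)
      then show "R \<le> card W" "S \<le> card W" using R S x by linarith+
    qed
    have pm: "p \<le> card V * card W"
      using Rn by (metis diff_le_self le_trans mult_le_mono2 p_def)
    \<comment> \<open>Gives \<open>p \<le> card W * S\<close>, so that the subtraction defining
      \<open>q\<close> is exact as well.\<close>
    have MRxS: "M * real R \<le> x * real S"
    proof -
      have "M \<le> C / 2 * x" by (rule small[OF \<eta>(6)])
      then have MS: "M \<le> real S" using S(2) M1 by linarith
      have "a * x \<le> x" using a M0 by (auto intro: mult_left_le_one_le)
      then have "real R \<le> x" using R by linarith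
      then have "M * real R \<le> real S * x" using MS M0 by (intro mult_mono) auto
      then show ?thesis by (simp add: mult.commute)
    qed
    then have "real (card V * R) \<le> real (card W * S)" by (simp add: M x)
    then have "card V * R \<le> card W * S" by (simp only: of_nat_le_iff)
    then have pS: "p \<le> card W * S" by (simp add: p_def)
    define q where "q = card W * S - p"
    have q: "p + q = card W * S" using pS by (simp add: q_def)
    have qm: "q \<le> (card W)\<^sup>2"
      using Sn by (metis diff_le_self le_trans mult_le_mono2 power2_eq_square q_def)
    have block: "card (block_incidences V W k p q) \<le> (card V + card W + 1) ^ (2 * (card V + card W)) * card ?I"
      by (rule card_block_incidences_le[OF fin disj p q])
    have bpos: "0 < card (block_incidences V W k p q)"
      by (rule ln_card_block_incidences(1)[OF fin disj cV cW km pm qm])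
    then have Ipos: "0 < card ?I" using block by (metis gr0I leD mult_0_right)
    have "real (card (block_incidences V W k p q)) \<le> (M + x + 1) ^ (2 * (card V + card W)) * real (card ?I)"
    proof -
      have "real (card (block_incidences V W k p q))
          \<le> real ((card V + card W + 1) ^ (2 * (card V + card W)) * card ?I)"
        using block by (simp only: of_nat_le_iff)
      then show ?thesis by (simp add: M x add_ac)
    qed
    then have "ln (real (card (block_incidences V W k p q)))
        \<le> ln ((M + x + 1) ^ (2 * (card V + card W)) * real (card ?I))"
      using bpos by (intro ln_mono) auto
    also have "\<dots> = ln ((M + x + 1) ^ (2 * (card V + card W))) + ln (real (card ?I))"
      using Ipos M0 by (subst ln_mult) auto
    also have "ln ((M + x + 1) ^ (2 * (card V + card W))) = 2 * (M + x) * ln (M + x + 1)"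
      using M0 by (subst ln_realpow) (auto simp: M x)
    also have "\<dots> \<le> (4 * x) * ln (2 * x + 1)"
      by (rule mult_mono) (use M0 Mx in auto)
    finally have block_ln: "ln (real (card (block_incidences V W k p q)))
        \<le> 4 * x * ln (2 * x + 1) + ln (real (card ?I))" by simp
    define h where "h = real k / M\<^sup>2 - y"
    have M2: "1 \<le> M\<^sup>2" using M1 by simp
    have hb: "\<bar>h\<bar> \<le> 1 / M\<^sup>2"
    proof -
      have "h = (real k - y * M\<^sup>2) / M\<^sup>2" using M1 by (simp add: h_def diff_divide_distrib)
      then have "\<bar>h\<bar> = \<bar>real k - y * M\<^sup>2\<bar> / M\<^sup>2" by (simp add: abs_divide)
      also have "\<dots> \<le> 1 / M\<^sup>2" using k by (intro divide_right_mono) auto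
      finally show ?thesis .
    qed
    \<comment> \<open>The condition \<open>1 \<le> \<eta> * M\<close> brings the rounding error
      \<open>h\<close> of the density below \<open>e2\<close>.\<close>
    have "1 / M\<^sup>2 \<le> 1 / M"
      using M1 by (intro divide_left_mono) (auto simp: power2_eq_square)
    also have "\<dots> \<le> \<eta>" using \<eta>M M1 by (simp add: divide_le_eq)
    finally have "\<bar>h\<bar> \<le> e2" using hb \<eta> by linarith
    then have "- (K2 * h\<^sup>2) \<le> bin_entropy (y + h) - bin_entropy y - Ly * h"
      using T2[of h] by linarith
    then have "- (K2 * h\<^sup>2) * M\<^sup>2 \<le> (bin_entropy (y + h) - bin_entropy y - Ly * h) * M\<^sup>2"
      by (intro mult_right_mono) auto
    \<comment> \<open>Both \<open>\<bar>h\<bar> * M^2\<close> and \<open>\<bar>h\<bar>\<close> are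
      at most 1, so rounding costs at most \<open>K2\<close>, and a fortiori at most
      \<open>K2 * x\<close>.\<close>
    moreover have "K2 * h\<^sup>2 * M\<^sup>2 \<le> K2 * x"
    proof -
      have "\<bar>h\<bar> * M\<^sup>2 \<le> 1" using hb M1 by (simp add: le_divide_eq)
      moreover have "\<bar>h\<bar> \<le> 1" using hb M2 by (smt (verit) divide_le_eq_1)
      ultimately have "\<bar>h\<bar> * (\<bar>h\<bar> * M\<^sup>2) \<le> 1 * 1" by (intro mult_mono) auto
      then have "h\<^sup>2 * M\<^sup>2 \<le> x" using x1 by (simp add: power2_eq_square mult.assoc[symmetric])
      then show ?thesis using K2 by (simp add: mult.assoc mult_left_mono)
    qed
    ultimately have hM: "- (K2 * x) \<le> (bin_entropy (real k / M\<^sup>2) - bin_entropy y - Ly * (real k / M\<^sup>2 - y)) * M\<^sup>2"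
      by (simp add: h_def)
    \<comment> \<open>Four logarithms, counted with multiplicity, cost
      \<open>2 * x * ln (2 * x + 1)\<close> each; the 4 from \<open>block_ln\<close> then makes the
      constant 12.\<close>
    have "ln (M\<^sup>2 + 1) + 2 * ln (M * x + 1) + ln (x\<^sup>2 + 1) \<le> 8 * x * ln (2 * x + 1)"
      using lnle[of "M\<^sup>2"] lnle[of "M * x"] lnle[of "x\<^sup>2"] sq M0 by simp
    then have lower: "\<Phi> - ?err - K2 * x - 12 * x * ln (2 * x + 1) \<le> ln (real (card ?I))"
      using ln_card_block_incidences(3)[OF fin disj cV cW km pm qm] G[OF p q km] hM block_ln
      unfolding M[symmetric] x[symmetric] by linarith
    have "ln (real (card ?I)) \<le> ln ((M\<^sup>2 + 1) * exp (\<Phi> + ?err))"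
      using upper Ipos by (intro ln_mono) auto
    also have "\<dots> = ln (M\<^sup>2 + 1) + (\<Phi> + ?err)"
      using M2 by (subst ln_mult) auto
    finally have "ln (real (card ?I)) \<le> \<Phi> + ?err + 2 * x * ln (2 * x + 1)"
      using lnle[of "M\<^sup>2"] sq by simp
    moreover have "0 \<le> x * ln (2 * x + 1)" using lnx M0 by simp
    moreover have "?err + K2 * x \<le> K * (M ^ 3 / x + x)" "?err \<le> K * (M ^ 3 / x + x)"
    proof -
      have "0 \<le> K2 * (M ^ 3 / x)" "0 \<le> K2 * x" using K2 M0 by simp_all
      then show "?err + K2 * x \<le> K * (M ^ 3 / x + x)" "?err \<le> K * (M ^ 3 / x + x)"
        unfolding K_def distrib_left distrib_right by linarith+
    qed
    ultimately show ?thesis using lower unfolding \<Phi>_def[symmetric] by (simp add: abs_le_iff)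
  qed
  moreover have "0 \<le> K" using K2 by (simp add: K_def)
  ultimately show ?thesis using \<eta>(1) unfolding Ly_def LC_def c_def by blast
qed

section \<open>Two-block tables and the maximising density\<close>

lemma card_two_block_tables:
  fixes n :: nat and \<delta> B C :: real
  defines "m \<equiv> nat \<lfloor>real n powr \<delta>\<rfloor>"
  defines "s \<equiv> \<lambda>i. if i \<in> {..<m} then nat \<lfloor>B * C * real n\<rfloor> else nat \<lfloor>C * real n\<rfloor>"
  shows "card (two_block_tables n \<delta> B C)
    = card (incidences ({..<m} \<union> {m..<m + n}) ({..<m} \<union> {m..<m + n}) s s)"
proof -
  have "{..<m} \<union> {m..<m + n} = {..<m + n}" by auto
  moreover have "incidences {..<m + n} {..<m + n} (($) (two_block_margin n \<delta> B C)) (($) (two_block_margin n \<delta> B C))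
    = incidences {..<m + n} {..<m + n} s s"
    by (rule incidences_cong) (auto simp: two_block_margin_def s_def m_def)
  moreover have "dim_vec (two_block_margin n \<delta> B C) = m + n"
    by (simp add: two_block_margin_def m_def)
  ultimately show ?thesis
    unfolding two_block_tables_def card_binary_tables by simp
qed

text \<open>Completing the square shows that the denominator \<open>D\<close> is positive, and
  \<open>D - B^2 * (1 - C) = (1 - B * C)^2 / C\<close> factors \<open>1 - z11_star B C\<close>. The
  last equation is the exponentiated critical point condition.\<close>

lemma z11_star_critical:
  fixes B C :: real
  assumes B: "0 < B" and C: "0 < C" "C < 1" and BC: "B * C < 1"
  shows "0 < z11_star B C" "z11_star B C < 1"
    and "(1 - z11_star B C) / z11_star B C = inverse ((1 - C) / C * ((B * C)\<^sup>2 / (1 - B * C)\<^sup>2))"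
proof -
  define D where "D = B\<^sup>2 - 2 * B + 1 / C"
  have "D = (B - 1)\<^sup>2 + (1 - C) / C"
    using C by (simp add: D_def power2_eq_square field_simps)
  moreover have "0 < (1 - C) / C" using C by simp
  ultimately have D: "0 < D" by (metis add_nonneg_pos zero_le_power2)
  have z: "z11_star B C = B\<^sup>2 * (1 - C) / D" by (simp add: z11_star_def D_def)
  have "D - B\<^sup>2 * (1 - C) = (1 - B * C)\<^sup>2 / C"
    using C by (simp add: D_def power2_eq_square field_simps)
  then have w: "1 - z11_star B C = (1 - B * C)\<^sup>2 / C / D"
    unfolding z using D by (metis diff_divide_distrib divide_self_if less_numeral_extra(3))
  have BC': "0 < (1 - B * C)\<^sup>2" using BC by simp
  show pos: "0 < z11_star B C" unfolding z using B C D by simp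
  have "0 < 1 - z11_star B C" unfolding w using BC' C D by (intro divide_pos_pos)
  then show "z11_star B C < 1" by simp
  have ne: "B \<noteq> 0" "C \<noteq> 0" "1 - C \<noteq> 0" "1 - B * C \<noteq> 0" "D \<noteq> 0" using B C BC D by auto
  have "(1 - z11_star B C) / z11_star B C = ((1 - B * C)\<^sup>2 / C) / (B\<^sup>2 * (1 - C))"
    unfolding w unfolding z using ne(5) by simp
  also have "\<dots> = inverse ((1 - C) / C * ((B * C)\<^sup>2 / (1 - B * C)\<^sup>2))"
    using ne by (simp add: power2_eq_square field_simps)
  finally show "(1 - z11_star B C) / z11_star B C = inverse ((1 - C) / C * ((B * C)\<^sup>2 / (1 - B * C)\<^sup>2))" .
qed

theorem mainTheorem1:
  fixes \<delta> B C :: real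
  assumes "0 < \<delta>" and "\<delta> < 1"
    and "0 < C" and "C < 3 / 4"
    and "0 < B" and "B < 1 / (sqrt (C / 3 - C\<^sup>2 / 3) + C)"
  shows "(\<lambda>n::nat. ln (real (card (two_block_tables n \<delta> B C)))
            - (bin_entropy C * (real n)\<^sup>2
               + (2 * bin_entropy (B * C) - (B * C) * ln ((1 - C) / C)) * real n powr (1 + \<delta>)
               + (bin_entropy (z11_star B C)
                    + z11_star B C * ln ((1 - C) / C * ((B * C)\<^sup>2 / (1 - B * C)\<^sup>2))
                    - B\<^sup>2 * C / (2 * (1 - C))) * real n powr (2 * \<delta>)))
         \<in> O(\<lambda>n. real n powr (3 * \<delta> - 1) + real n * ln (real n))"
proof -
  define a where "a = B * C"
  define y where "y = z11_star B C"
  define L where "L = ln ((1 - C) / C * ((B * C)\<^sup>2 / (1 - B * C)\<^sup>2))"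
  have C: "0 < C" "C < 1" using assms by auto
  \<comment> \<open>The square root is nonnegative, so the bound on \<open>B\<close> yields
    \<open>B * C < 1\<close>, that is \<open>a < 1\<close>.\<close>
  have "0 \<le> C / 3 - C\<^sup>2 / 3" using C by (simp add: power2_eq_square)
  then have sqrt: "0 \<le> sqrt (C / 3 - C\<^sup>2 / 3)" by simp
  then have "B * (sqrt (C / 3 - C\<^sup>2 / 3) + C) < 1"
    using assms(6) C by (simp add: less_divide_eq add_nonneg_pos)
  moreover have "B * C \<le> B * (sqrt (C / 3 - C\<^sup>2 / 3) + C)"
    using sqrt assms(5) by (intro mult_left_mono) auto
  ultimately have "B * C < 1" by linarith
  then have a: "0 < a" "a < 1" using assms(5) C by (simp_all add: a_def)
  have y: "0 < y" "y < 1" and ratio: "(1 - y) / y = inverse ((1 - C) / C * (a\<^sup>2 / (1 - a)\<^sup>2))"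
    using z11_star_critical[OF assms(5) C] a unfolding y_def a_def by auto
  \<comment> \<open>Thus \<open>y * L\<close> in the claim agrees with the term
    \<open>- y * ln ((1 - y) / y)\<close> of the maximal value.\<close>
  have Ly: "ln ((1 - y) / y) = - L"
    unfolding ratio L_def a_def[symmetric] by (rule ln_inverse)
  have "L = ln ((1 - C) / C) - 2 * ln ((1 - a) / a)"
    unfolding L_def a_def[symmetric] using a C by (simp add: ln_mult ln_div ln_realpow)
  then have crit: "ln ((1 - y) / y) = 2 * ln ((1 - a) / a) - ln ((1 - C) / C)"
    using Ly by simp
  define c1 where "c1 = 2 * bin_entropy a - a * ln ((1 - C) / C)"
  define c2 where "c2 = bin_entropy y + y * L - B\<^sup>2 * C / (2 * (1 - C))"
  have c2: "c2 = bin_entropy y - y * ln ((1 - y) / y) - a\<^sup>2 / (2 * C * (1 - C))"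
    using C unfolding Ly c2_def a_def by (simp add: power2_eq_square)
  obtain K \<eta> where K: "0 \<le> K" and \<eta>: "0 < \<eta>" and bound:
    "\<forall>(V :: nat set) W R S M x. finite V \<and> finite W \<and> V \<inter> W = {} \<and>
      M = real (card V) \<and> x = real (card W) \<and> 1 \<le> \<eta> * M \<and> M \<le> \<eta> * x \<and>
      real R \<le> a * x \<and> a * x \<le> real R + 1 \<and> real S \<le> C * x \<and> C * x \<le> real S + 1 \<longrightarrow>
    \<bar>ln (real (card (incidences (V \<union> W) (V \<union> W) (\<lambda>i. if i \<in> V then R else S)
        (\<lambda>i. if i \<in> V then R else S))))
      - (bin_entropy C * x\<^sup>2 + c1 * (x * M) + c2 * M\<^sup>2)\<bar>
    \<le> K * (M ^ 3 / x + x) + 12 * x * ln (2 * x + 1)"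
    using ln_card_two_block_incidences[OF a C y crit, folded c1_def c2]
    by (elim exE conjE) (rule that, assumption+)
  define g where "g n = real n powr (3 * \<delta> - 1) + real n * ln (real n)" for n
  \<comment> \<open>As \<open>M\<close> is at least \<open>n powr \<delta> - 1\<close>, this secures
    \<open>1 \<le> \<eta> * M\<close>; the next condition secures
    \<open>M \<le> \<eta> * x\<close>.\<close>
  have "eventually (\<lambda>n::nat. 1 \<le> \<eta> * (real n powr \<delta> - 1)) at_top"
    using assms(1) \<eta> by real_asymp
  moreover have "eventually (\<lambda>n::nat. real n powr \<delta> \<le> \<eta> * real n) at_top"
    using assms(1,2) \<eta> by real_asymp
  moreover have "eventually (\<lambda>n::nat. 3 \<le> n) at_top" by (rule eventually_ge_at_top)
  ultimately have "eventually (\<lambda>n. norm (ln (real (card (two_block_tables n \<delta> B C)))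
      - (bin_entropy C * (real n)\<^sup>2 + c1 * real n powr (1 + \<delta>) + c2 * real n powr (2 * \<delta>)))
    \<le> (K + 24 + \<bar>c1\<bar> + 2 * \<bar>c2\<bar>) * norm (g n)) at_top"
  proof eventually_elim
    case (elim n)
    define x where "x = real n"
    define m where "m = nat \<lfloor>x powr \<delta>\<rfloor>"
    define M where "M = real m"
    have x3: "3 \<le> x" using elim by (simp add: x_def)
    have "0 \<le> x powr \<delta>" by simp
    then have M: "M \<le> x powr \<delta>" "x powr \<delta> \<le> M + 1" unfolding M_def m_def by linarith+
    have "\<eta> * (x powr \<delta> - 1) \<le> \<eta> * M" using M \<eta> by (intro mult_left_mono) auto
    then have \<eta>M: "1 \<le> \<eta> * M" "M \<le> \<eta> * x" using elim M unfolding x_def by linarith+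
    define R where "R = nat \<lfloor>B * C * x\<rfloor>"
    define S where "S = nat \<lfloor>C * x\<rfloor>"
    have "0 \<le> B * C * x" "0 \<le> C * x" using a C x3 by (auto simp: a_def)
    then have R: "real R \<le> a * x" "a * x \<le> real R + 1" and S: "real S \<le> C * x" "C * x \<le> real S + 1"
      unfolding R_def S_def a_def by linarith+
    have "\<bar>ln (real (card (two_block_tables n \<delta> B C)))
      - (bin_entropy C * x\<^sup>2 + c1 * (x * M) + c2 * M\<^sup>2)\<bar>
      \<le> K * (M ^ 3 / x + x) + 12 * x * ln (2 * x + 1)"
      unfolding card_two_block_tables x_def[symmetric] m_def[symmetric] R_def[symmetric] S_def[symmetric]
      by (rule bound[rule_format]) (use \<eta>M R S in \<open>auto simp: M_def x_def\<close>)
    \<comment> \<open>Rounding \<open>x powr \<delta>\<close> down to \<open>M\<close> changes it by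
      at most 1. This costs a multiple of \<open>x\<close> here and, after factoring a difference of
      squares, also in the \<open>c2\<close> term.\<close>
    moreover have "\<bar>c1 * (x * M) - c1 * x powr (1 + \<delta>)\<bar> \<le> \<bar>c1\<bar> * x"
    proof -
      have "c1 * (x * M) - c1 * x powr (1 + \<delta>) = c1 * (x * (M - x powr \<delta>))"
        using x3 by (simp add: powr_add algebra_simps)
      moreover have "x * \<bar>M - x powr \<delta>\<bar> \<le> x * 1" using M x3 by (intro mult_left_mono) auto
      ultimately show ?thesis using x3 by (simp add: abs_mult mult_left_mono)
    qed
    moreover have "\<bar>c2 * M\<^sup>2 - c2 * x powr (2 * \<delta>)\<bar> \<le> 2 * \<bar>c2\<bar> * x"
    proof -
      have xx: "x powr \<delta> \<le> x powr 1" using assms(2) x3 by (intro powr_mono) auto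
      have "x powr (2 * \<delta>) = x powr \<delta> * x powr \<delta>" by (simp add: powr_add[symmetric])
      then have "c2 * M\<^sup>2 - c2 * x powr (2 * \<delta>) = c2 * ((M - x powr \<delta>) * (M + x powr \<delta>))"
        by (simp add: power2_eq_square algebra_simps)
      moreover have "\<bar>M - x powr \<delta>\<bar> * \<bar>M + x powr \<delta>\<bar> \<le> 1 * (2 * x)"
        using M xx x3 by (intro mult_mono) (auto simp: M_def)
      then have "\<bar>c2\<bar> * (\<bar>M - x powr \<delta>\<bar> * \<bar>M + x powr \<delta>\<bar>) \<le> \<bar>c2\<bar> * (1 * (2 * x))"
        by (rule mult_left_mono) simp
      ultimately show ?thesis by (simp add: abs_mult)
    qed
    moreover have "M ^ 3 / x \<le> x powr (3 * \<delta> - 1)"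
    proof -
      have "M ^ 3 \<le> (x powr \<delta>) ^ 3" using M by (intro power_mono) (auto simp: M_def)
      also have "\<dots> = x powr (3 * \<delta>)" using x3 by (simp add: powr_power mult.commute)
      finally show ?thesis using x3 by (simp add: powr_diff divide_right_mono)
    qed
    then have "K * (M ^ 3 / x) \<le> K * x powr (3 * \<delta> - 1)" using K by (intro mult_left_mono)
    \<comment> \<open>Since 3 exceeds e, every error linear in \<open>x\<close> is absorbed by
      \<open>x * ln x\<close>.\<close>
    moreover have lnx: "1 \<le> ln x"
      using x3 exp_le by (subst ln_ge_iff) auto
    then have xl: "x \<le> x * ln x" using x3 by (simp add: mult_le_cancel_left1)
    then have "K * x \<le> K * (x * ln x)" "\<bar>c1\<bar> * x \<le> \<bar>c1\<bar> * (x * ln x)"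
      "2 * \<bar>c2\<bar> * x \<le> 2 * \<bar>c2\<bar> * (x * ln x)"
      using K by (auto intro!: mult_left_mono)
    \<comment> \<open>For \<open>x\<close> at least 3, \<open>2 * x + 1\<close> is at most
      \<open>x^2\<close>, which doubles the constant.\<close>
    moreover have "12 * x * ln (2 * x + 1) \<le> 24 * (x * ln x)"
    proof -
      have "3 * x \<le> x * x" using x3 by (intro mult_right_mono) auto
      then have "2 * x + 1 \<le> x\<^sup>2" using x3 unfolding power2_eq_square by linarith
      then have "ln (2 * x + 1) \<le> ln (x\<^sup>2)" using x3 by (subst ln_le_cancel_iff) auto
      also have "\<dots> = 2 * ln x" using x3 by (simp add: ln_realpow)
      finally have "x * ln (2 * x + 1) \<le> x * (2 * ln x)" using x3 by (intro mult_left_mono) auto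
      then show ?thesis by simp
    qed
    moreover have "0 \<le> (24 + \<bar>c1\<bar> + 2 * \<bar>c2\<bar>) * x powr (3 * \<delta> - 1)" by simp
    ultimately have "\<bar>ln (real (card (two_block_tables n \<delta> B C)))
      - (bin_entropy C * x\<^sup>2 + c1 * x powr (1 + \<delta>) + c2 * x powr (2 * \<delta>))\<bar>
      \<le> (K + 24 + \<bar>c1\<bar> + 2 * \<bar>c2\<bar>) * (x powr (3 * \<delta> - 1) + x * ln x)"
      unfolding distrib_left distrib_right by linarith
    moreover have "0 \<le> x powr (3 * \<delta> - 1) + x * ln x" using xl x3 by (intro add_nonneg_nonneg) auto
    ultimately show ?case unfolding g_def x_def by simp
  qed
  then show ?thesis
    unfolding g_def c1_def c2_def y_def a_def L_def by (rule bigoI)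
qed

end
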